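(* For all integers $n\ge 0$ and $k\ge j\ge 0$, the number of PDO partitions $\lambda$ of weight $2n$ with $\ell_d(\lambda)=k$ and $\ell_d^o(\lambda)=j$ equals the number of ordered pairs $(\mu\,|\,\nu)$ of PDO partitions with $|\mu|+|\nu|=n$, $\ell_d(\mu)+\ell_d(\nu)=k$ (i.e. $k$ designated parts in total), and $\ell_r(\mu,\nu)=j/2$. Restated in terms of generating functions: for all $n\ge 0$, $$[q^{2n}]\,P_1(x,y,q) = [q^n]\,P_2(x,y,q),$$ where $$P_1(x,y,q):=\sum_{\lambda\in\mathcal{PDO}}x^{\ell_d(\lambda)}y^{\ell_d^o(\lambda)}q^{|\lambda|},\qquad P_2(x,y,q):=\sum_{(\mu|\nu)\in\mathcal{PDO}\times\mathcal{PDO}}x^{\ell_d(\mu)+\ell_d(\nu)}y^{2\ell_r(\mu,\nu)}q^{|\mu|+|\nu|}.$$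
   Context: A PDO partition (partition into odd parts with designated summands) of a nonnegative integer $n$ is an integer partition of $n$ all of whose parts are odd, together with a choice, for each part size that occurs, of exactly one of its occurrences (the "designated" one). Occurrences of the same part size are distinguished by position, so a part size occurring $t$ times can be designated in $t$ ways. The weight $|\lambda|$ is the sum of all parts of $\lambda$. $\mathcal{PDO}$ is the set of all PDO partitions of all nonnegative integers, including the empty partition (of weight $0$). For $\lambda\in\mathcal{PDO}$, $\ell_d(\lambda)$ is the number of different part sizes occurring in $\lambda$, and $\ell_d^o(\lambda)$ is the number of different part sizes that occur an odd number of times in $\lambda$. For a pair $(\mu\,|\,\nu)$ of PDO partitions, $\ell_r(\mu,\nu)$ is the number of different part sizes that occur in both $\mu$ and $\nu$. $[q^n]F$ denotes the coefficient of $q^n$ in the formal power series $F$ in $q$ (here with coefficients in $\mathbb{Z}[x,y]$). *)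

theory Defs
  imports
    "HOL-Analysis.Infinite_Sum"
    "HOL-Library.FuncSet"
    "HOL-Library.Multiset"
    "HOL-Computational_Algebra.Polynomial"
    "HOL-Computational_Algebra.Formal_Power_Series"
begin

section \<open>Partitions into odd parts with designated summands\<close>

text \<open>
  A PDO partition is a pair \<open>(M, d)\<close>: \<open>M\<close> is the multiset of parts and \<open>d p\<close>, for a part size
  \<open>p\<close> occurring \<open>t\<close> times, is the position in \<open>{1..t}\<close> (among the occurrences of \<open>p\<close>) of the
  designated occurrence. Outside the part sizes of \<open>M\<close> the function \<open>d\<close> is
  \<^const>\<open>undefined\<close> (by \<^const>\<open>PiE\<close>), so distinct pairs are distinct PDO partitions.
\<close>

type_synonym pdo = "nat multiset \<times> (nat \<Rightarrow> nat)"

definition PDO :: "pdo set" where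
  "PDO = (SIGMA M : {M. \<forall>p \<in># M. odd p}. (\<Pi>\<^sub>E p \<in> set_mset M. {1..count M p}))"

definition weight :: "pdo \<Rightarrow> nat" where
  "weight \<rho> = sum_mset (fst \<rho>)"

definition ell_d :: "pdo \<Rightarrow> nat" where
  "ell_d \<rho> = card (set_mset (fst \<rho>))"

definition ell_do :: "pdo \<Rightarrow> nat" where
  "ell_do \<rho> = card {p \<in> set_mset (fst \<rho>). odd (count (fst \<rho>) p)}"

definition ell_r :: "pdo \<Rightarrow> pdo \<Rightarrow> nat" where
  "ell_r \<mu> \<nu> = card (set_mset (fst \<mu>) \<inter> set_mset (fst \<nu>))"

section \<open>Generating functions\<close>

text \<open>
  The coefficient ring is \<open>\<int>[x, y] = \<int>[x][y]\<close>: \<open>x\<close> is the indeterminate of the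
  inner polynomial ring and \<open>y\<close> that of the outer one. The infinite sums are taken in the
  coefficientwise (\<open>q\<close>-adic) topology on formal power series; they converge, see
  \<open>P1_has_sum\<close> and \<open>P2_has_sum\<close> below.
\<close>

definition var_x :: "int poly poly" where
  "var_x = [:[:0, 1:]:]"

definition var_y :: "int poly poly" where
  "var_y = [:0, 1:]"

definition P1 :: "int poly poly fps" where
  "P1 = infsum (\<lambda>\<rho>. fps_const (var_x ^ ell_d \<rho> * var_y ^ ell_do \<rho>) * fps_X ^ weight \<rho>) PDO"

definition P2 :: "int poly poly fps" where
  "P2 = infsum (\<lambda>(\<mu>, \<nu>). fps_const (var_x ^ (ell_d \<mu> + ell_d \<nu>) * var_y ^ (2 * ell_r \<mu> \<nu>))
                           * fps_X ^ (weight \<mu> + weight \<nu>)) (PDO \<times> PDO)"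

section \<open>Well-definedness: finiteness and convergence\<close>

lemma size_le_sum_mset: "(\<forall>p \<in># M. 0 < p) \<Longrightarrow> size M \<le> sum_mset (M :: nat multiset)"
  by (induction M) auto

lemma finite_PDO_le: "finite {\<rho> \<in> PDO. weight \<rho> \<le> n}"
proof -
  define A where "A = {M :: nat multiset. (\<forall>p \<in># M. odd p) \<and> sum_mset M \<le> n}"
  have "A \<subseteq> mset ` {xs. set xs \<subseteq> {..n} \<and> length xs \<le> n}"
  proof
    fix M assume M: "M \<in> A"
    obtain xs where xs: "M = mset xs" by (metis ex_mset)
    have "size M \<le> sum_mset M"
      using M by (intro size_le_sum_mset) (auto simp: A_def intro: odd_pos)
    hence "length xs \<le> n" using M xs by (simp add: A_def)
    moreover have "p \<le> n" if "p \<in> set xs" for p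
      using that M member_le_sum_list[of p xs] unfolding xs A_def by (simp add: sum_mset_sum_list)
    ultimately show "M \<in> mset ` {xs. set xs \<subseteq> {..n} \<and> length xs \<le> n}"
      using xs by auto
  qed
  hence "finite A"
    by (rule finite_subset) (intro finite_imageI finite_lists_length_le, simp)
  hence "finite (SIGMA M : A. (\<Pi>\<^sub>E p \<in> set_mset M. {1..count M p}))"
    by (intro finite_SigmaI finite_PiE) auto
  thus ?thesis
    by (rule finite_subset[rotated]) (auto simp: PDO_def A_def weight_def)
qed

lemma finite_PDO: "finite {\<rho> \<in> PDO. weight \<rho> = n}"
  by (rule finite_subset[OF _ finite_PDO_le[of n]]) auto

lemma finite_PDO_pairs: "finite {a \<in> PDO \<times> PDO. weight (fst a) + weight (snd a) = n}"
  by (rule finite_subset[OF _ finite_cartesian_product[OF finite_PDO_le[of n] finite_PDO_le[of n]]])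
     auto

lemma has_sum_fps_monomials:
  fixes c :: "'a \<Rightarrow> 'b :: comm_ring_1" and w :: "'a \<Rightarrow> nat"
  assumes fin: "\<And>n. finite {a \<in> A. w a = n}"
  shows "((\<lambda>a. fps_const (c a) * fps_X ^ w a) has_sum
            Abs_fps (\<lambda>n. \<Sum>a | a \<in> A \<and> w a = n. c a)) A"
  unfolding has_sum_def
proof (rule tendsto_fpsI)
  fix n
  have "fps_nth (\<Sum>a\<in>F. fps_const (c a) * fps_X ^ w a) n = (\<Sum>a | a \<in> A \<and> w a = n. c a)"
    if F: "finite F" "{a \<in> A. w a = n} \<subseteq> F" "F \<subseteq> A" for F
  proof -
    have "fps_nth (\<Sum>a\<in>F. fps_const (c a) * fps_X ^ w a) n = (\<Sum>a\<in>F. if w a = n then c a else 0)"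
      by (auto simp: fps_sum_nth fps_X_power_iff intro!: sum.cong)
    also have "\<dots> = sum c {a \<in> F. w a = n}"
      using F(1) by (simp add: sum.inter_filter)
    also have "{a \<in> F. w a = n} = {a. a \<in> A \<and> w a = n}"
      using F by auto
    finally show ?thesis .
  qed
  thus "\<forall>\<^sub>F F in finite_subsets_at_top A.
          fps_nth (\<Sum>a\<in>F. fps_const (c a) * fps_X ^ w a) n
            = fps_nth (Abs_fps (\<lambda>n. \<Sum>a | a \<in> A \<and> w a = n. c a)) n"
    using fin[of n] unfolding eventually_finite_subsets_at_top by auto
qed

lemma P1_has_sum:
  "((\<lambda>\<rho>. fps_const (var_x ^ ell_d \<rho> * var_y ^ ell_do \<rho>) * fps_X ^ weight \<rho>) has_sum P1) PDO"
  unfolding P1_def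
  by (intro has_sum_infsum has_sum_imp_summable[OF has_sum_fps_monomials[OF finite_PDO]])

lemma P2_has_sum:
  "((\<lambda>(\<mu>, \<nu>). fps_const (var_x ^ (ell_d \<mu> + ell_d \<nu>) * var_y ^ (2 * ell_r \<mu> \<nu>))
                * fps_X ^ (weight \<mu> + weight \<nu>)) has_sum P2) (PDO \<times> PDO)"
  unfolding P2_def case_prod_unfold
  by (intro has_sum_infsum has_sum_imp_summable[OF has_sum_fps_monomials[OF finite_PDO_pairs]])

lemma P1_nth:
  "fps_nth P1 n = (\<Sum>\<rho> | \<rho> \<in> PDO \<and> weight \<rho> = n. var_x ^ ell_d \<rho> * var_y ^ ell_do \<rho>)"
  unfolding P1_def infsumI[OF has_sum_fps_monomials[OF finite_PDO]] by simp

lemma P2_nth: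
  "fps_nth P2 n = (\<Sum>(\<mu>, \<nu>) | (\<mu>, \<nu>) \<in> PDO \<times> PDO \<and> weight \<mu> + weight \<nu> = n.
                    var_x ^ (ell_d \<mu> + ell_d \<nu>) * var_y ^ (2 * ell_r \<mu> \<nu>))"
  unfolding P2_def case_prod_unfold infsumI[OF has_sum_fps_monomials[OF finite_PDO_pairs]]
  by (simp add: mem_Times_iff)

end

theory Submission
  imports Defs
begin

text \<open>
  Both generating functions are products over the odd numbers \<open>p\<close>. With \<open>a + b = x y\<close> and
  \<open>a b = 2 x - 4\<close>, the factor of \<open>P\<^sub>1\<close> is \<open>(1 + a z + z\<^sup>2) (1 + b z + z\<^sup>2) / (1 - z\<^sup>2)\<^sup>2\<close> for
  \<open>z = q\<^sup>p\<close>. Writing \<open>a = \<zeta> + 1/\<zeta>\<close> and \<open>b = \<xi> + 1/\<xi>\<close>, the factor of \<open>P\<^sub>2\<close> is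
  \<open>(1 + c z + z\<^sup>2) (1 + d z + z\<^sup>2) / (1 - z)\<^sup>4\<close> with \<open>c = \<zeta> \<xi> + 1/(\<zeta> \<xi>)\<close> and \<open>d = \<zeta>/\<xi> + \<xi>/\<zeta>\<close>.
  By the Jacobi triple product the numerators are, up to a common Euler product, products of two
  theta functions \<open>\<theta>(\<zeta>) \<theta>(\<xi>)\<close> and \<open>\<theta>(\<zeta> \<xi>) \<theta>(\<zeta>/\<xi>)\<close>, where \<open>\<theta>(u) = \<Sum>\<^sub>n u\<^sup>n q\<^bsup>n^2\<^esup>\<close>. The
  substitution \<open>m = r + s\<close>, \<open>l = r - s\<close> in \<open>m\<^sup>2 + l\<^sup>2 = 2 (r\<^sup>2 + s\<^sup>2)\<close> shows that the even part of the
  former is the latter with \<open>q\<close> replaced by \<open>q\<^sup>2\<close>, and the remaining factors are even or match.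
  The identity is proved for complex values of \<open>x\<close> and \<open>y\<close>, where \<open>\<zeta>\<close> and \<open>\<xi>\<close> exist, and for
  coefficients up to a fixed degree, where finite products suffice.
\<close>

section \<open>Agreement of power series up to a given degree\<close>

text \<open>Congruence modulo \<open>fps_X ^ (n + 1)\<close>. The rules below make it a ring
  congruence, so finite truncations can stand in for infinite products and theta series.\<close>

definition fps_eq_upto :: "nat \<Rightarrow> 'a::comm_ring_1 fps \<Rightarrow> 'a fps \<Rightarrow> bool" where
  "fps_eq_upto n f g \<longleftrightarrow> (\<forall>i\<le>n. fps_nth f i = fps_nth g i)"

lemma fps_eq_upto_refl [simp]: "fps_eq_upto n f f"
  by (simp add: fps_eq_upto_def)

lemma fps_eq_upto_sym: "fps_eq_upto n f g \<Longrightarrow> fps_eq_upto n g f"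
  by (simp add: fps_eq_upto_def)

lemma fps_eq_upto_trans [trans]: "fps_eq_upto n f g \<Longrightarrow> fps_eq_upto n g h \<Longrightarrow> fps_eq_upto n f h"
  by (simp add: fps_eq_upto_def)

lemma fps_eq_upto_mono: "fps_eq_upto n f g \<Longrightarrow> m \<le> n \<Longrightarrow> fps_eq_upto m f g"
  by (simp add: fps_eq_upto_def)

lemma fps_eq_upto_add:
  "fps_eq_upto n f g \<Longrightarrow> fps_eq_upto n f' g' \<Longrightarrow> fps_eq_upto n (f + f') (g + g')"
  by (simp add: fps_eq_upto_def)

lemma fps_eq_upto_mult:
  "fps_eq_upto n f g \<Longrightarrow> fps_eq_upto n f' g' \<Longrightarrow> fps_eq_upto n (f * f') (g * g')"
  unfolding fps_eq_upto_def fps_mult_nth by (auto intro!: sum.cong)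

lemma fps_eq_upto_power: "fps_eq_upto n f g \<Longrightarrow> fps_eq_upto n (f ^ k) (g ^ k)"
  by (induction k) (auto intro: fps_eq_upto_mult)

lemma fps_eq_upto_prod:
  "(\<And>i. i \<in> I \<Longrightarrow> fps_eq_upto n (f i) (g i)) \<Longrightarrow> fps_eq_upto n (\<Prod>i\<in>I. f i) (\<Prod>i\<in>I. g i)"
  by (induction I rule: infinite_finite_induct) (auto intro!: fps_eq_upto_mult)

lemma fps_eq_upto_sum:
  "(\<And>i. i \<in> I \<Longrightarrow> fps_eq_upto n (f i) (g i)) \<Longrightarrow> fps_eq_upto n (\<Sum>i\<in>I. f i) (\<Sum>i\<in>I. g i)"
  by (simp add: fps_eq_upto_def fps_sum_nth)

text \<open>A factor \<open>fps_X ^ k\<close> gains \<open>k\<close> degrees of precision; the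
  triple product relies on this gain.\<close>

lemma fps_eq_upto_X_power_mult:
  "fps_eq_upto n f g \<Longrightarrow> m \<le> n + k \<Longrightarrow> fps_eq_upto m (fps_X ^ k * f) (fps_X ^ k * g)"
  by (auto simp: fps_eq_upto_def fps_X_power_mult_nth)

lemma fps_eq_upto_add_X_power:
  "n < k \<Longrightarrow> fps_eq_upto n (f + fps_X ^ k * h) f"
  by (auto simp: fps_eq_upto_def fps_X_power_mult_nth)

lemma fps_eq_upto_cancel:
  fixes f g u :: "'a::field fps"
  assumes "fps_eq_upto n (f * u) (g * u)" "fps_nth u 0 \<noteq> 0"
  shows "fps_eq_upto n f g"
proof -
  have "fps_eq_upto n (f * u * inverse u) (g * u * inverse u)"
    by (intro fps_eq_upto_mult assms fps_eq_upto_refl)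
  thus ?thesis
    using assms(2) by (simp add: mult.assoc inverse_mult_eq_1')
qed

section \<open>The Jacobi triple product\<close>

text \<open>The Gaussian binomial coefficient. Its q-Pascal rule avoids division, so
  \<open>Q\<close> may lie in any commutative ring, here one of power series.\<close>

fun qbinom :: "'a::comm_ring_1 \<Rightarrow> nat \<Rightarrow> nat \<Rightarrow> 'a" where
  "qbinom Q n 0 = 1"
| "qbinom Q 0 (Suc k) = 0"
| "qbinom Q (Suc n) (Suc k) = qbinom Q n (Suc k) + Q ^ (n - k) * qbinom Q n k"

text \<open>The q-Pochhammer symbol (Q; Q)_n.\<close>

definition qfact :: "'a::comm_ring_1 \<Rightarrow> nat \<Rightarrow> 'a" where
  "qfact Q n = (\<Prod>i<n. 1 - Q ^ Suc i)"

lemma qfact_0 [simp]: "qfact Q 0 = 1"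
  and qfact_Suc: "qfact Q (Suc n) = qfact Q n * (1 - Q ^ Suc n)"
  by (simp_all add: qfact_def)

lemma qbinom_eq_0: "n < k \<Longrightarrow> qbinom Q n k = 0"
  by (induction Q n k rule: qbinom.induct) auto

text \<open>Division-free form of the quotient formula. The Pascal rule gives the induction step
  through 1 - Q^(n-l) + Q^(n-l) (1 - Q^(l+1)) = 1 - Q^(n+1).\<close>

lemma qbinom_qfact: "k \<le> n \<Longrightarrow> qbinom Q n k * qfact Q k * qfact Q (n - k) = qfact Q n"
proof (induction n arbitrary: k)
  case (Suc n)
  show ?case
  proof (cases k)
    case (Suc l)
    hence l: "l \<le> n" using Suc.prems by simp
    note IH = Suc.IH[OF l]
    \<comment> \<open>For \<open>l = n\<close> both sides vanish: the q-binomial lies outside its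
      range and 1 - Q^0 = 0.\<close>
    have 1: "qbinom Q n (Suc l) * qfact Q (Suc l) * qfact Q (n - l) = qfact Q n * (1 - Q ^ (n - l))"
    proof (cases "l = n")
      case False
      hence *: "n - l = Suc (n - Suc l)" using l by simp
      have "qbinom Q n (Suc l) * qfact Q (Suc l) * qfact Q (n - Suc l) = qfact Q n"
        using Suc.IH[of "Suc l"] False l by simp
      thus ?thesis unfolding * qfact_Suc[of Q "n - Suc l"] by (metis mult.assoc)
    qed (simp add: qbinom_eq_0)
    have pw: "Q ^ (n - l) * Q ^ Suc l = Q ^ Suc n"
      using l by (simp flip: power_add power_Suc)
    have "qbinom Q (Suc n) k * qfact Q k * qfact Q (Suc n - k) =
        qbinom Q n (Suc l) * qfact Q (Suc l) * qfact Q (n - l) +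
        Q ^ (n - l) * (1 - Q ^ Suc l) * (qbinom Q n l * qfact Q l * qfact Q (n - l))"
      by (simp only: Suc qbinom.simps diff_Suc_Suc qfact_Suc) (simp add: algebra_simps)
    also have "\<dots> = qfact Q n * (1 - Q ^ (n - l) * Q ^ Suc l)"
      unfolding 1 IH by (simp add: algebra_simps)
    also have "\<dots> = qfact Q (Suc n)"
      unfolding pw qfact_Suc ..
    finally show ?thesis .
  qed simp
qed simp

text \<open>In the last factor, \<open>u\<close> yields the first term of the Pascal rule and
  \<open>z * Q ^ n\<close> the second. The form homogeneous in \<open>u\<close> and \<open>z\<close>
  avoids negative powers of X in the triple product.\<close>

lemma q_binomial_theorem:
  "(\<Prod>k<n. u + z * Q ^ k) = (\<Sum>k\<le>n. qbinom Q n k * Q ^ (k choose 2) * z ^ k * u ^ (n - k))"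
proof (induction n)
  case (Suc n)
  let ?t = "\<lambda>n k. qbinom Q n k * Q ^ (k choose 2) * z ^ k * u ^ (n - k)"
  have 1: "(\<Sum>k\<le>n. ?t n k) * u = u ^ Suc n + (\<Sum>k\<le>n. qbinom Q n (Suc k) * Q ^ (Suc k choose 2) * z ^ Suc k * u ^ (n - k))"
  proof -
    have "(\<Sum>k\<le>n. ?t n k) * u = (\<Sum>k\<le>n. qbinom Q n k * Q ^ (k choose 2) * z ^ k * u ^ (Suc n - k))"
      unfolding sum_distrib_right by (intro sum.cong refl) (simp add: Suc_diff_le mult_ac)
    also have "\<dots> = (\<Sum>k\<le>Suc n. qbinom Q n k * Q ^ (k choose 2) * z ^ k * u ^ (Suc n - k))"
      by (simp add: qbinom_eq_0)
    also have "\<dots> = u ^ Suc n + (\<Sum>k\<le>n. qbinom Q n (Suc k) * Q ^ (Suc k choose 2) * z ^ Suc k * u ^ (n - k))"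
      unfolding sum.atMost_Suc_shift by (simp add: numeral_2_eq_2)
    finally show ?thesis .
  qed
  have 2: "(\<Sum>k\<le>n. ?t n k) * (z * Q ^ n) = (\<Sum>k\<le>n. Q ^ (n - k) * qbinom Q n k * Q ^ (Suc k choose 2) * z ^ Suc k * u ^ (n - k))"
    unfolding sum_distrib_right
  proof (intro sum.cong refl)
    fix k assume "k \<in> {..n}"
    hence "Q ^ n = Q ^ (n - k) * Q ^ k" by (simp flip: power_add)
    moreover have "Suc k choose 2 = k + (k choose 2)" by (simp add: numeral_2_eq_2)
    ultimately show "?t n k * (z * Q ^ n) = Q ^ (n - k) * qbinom Q n k * Q ^ (Suc k choose 2) * z ^ Suc k * u ^ (n - k)"
      by (simp add: power_add mult_ac)
  qed
  have "(\<Prod>k<Suc n. u + z * Q ^ k) = (\<Sum>k\<le>n. ?t n k) * u + (\<Sum>k\<le>n. ?t n k) * (z * Q ^ n)"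
    by (simp add: Suc.IH distrib_left)
  also have "\<dots> = u ^ Suc n + (\<Sum>k\<le>n. ?t (Suc n) (Suc k))"
    unfolding 1 2 by (simp add: sum.distrib[symmetric] algebra_simps del: power_Suc)
  also have "\<dots> = (\<Sum>k\<le>Suc n. ?t (Suc n) k)"
    unfolding sum.atMost_Suc_shift by (simp add: numeral_2_eq_2)
  finally show ?case .
qed (simp add: numeral_2_eq_2)

lemma finite_jacobi_triple_product:
  fixes \<zeta> :: "'a::field"
  assumes "\<zeta> \<noteq> 0"
  shows "(\<Prod>k<N. (1 + fps_const \<zeta> * fps_X ^ (2*k+1)) * (1 + fps_const (inverse \<zeta>) * fps_X ^ (2*k+1))) =
    (\<Sum>j = -int N..int N. fps_const (\<zeta> powi j) * qbinom (fps_X\<^sup>2) (2*N) (nat (int N + j)) * fps_X ^ nat (j\<^sup>2))"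
proof -
  let ?X = "fps_X :: 'a fps" and ?z = "fps_const \<zeta>" and ?w = "fps_const (inverse \<zeta>)"
  let ?L = "(\<Prod>k<N. (1 + ?z * ?X ^ (2*k+1)) * (1 + ?w * ?X ^ (2*k+1)))"
  txt \<open>Homogeneous \<open>q\<close>-binomial theorem with \<open>u = X\<^sup>2\<^sup>N\<close> and \<open>z = \<zeta> X\<close>: taking \<open>\<zeta> X\<^sup>2\<^sup>k\<^sup>+\<^sup>1\<close> out of the
    factors with \<open>k < N\<close> turns them into the factors with \<open>\<zeta>\<close> inverted, and all powers of \<open>X\<close> add
    up to \<open>3N\<^sup>2\<close>, which is then cancelled.\<close>
  have zw: "?z * ?w = 1" using assms by (simp add: fps_const_mult)
  have Xodd: "(\<Prod>k<n. ?X ^ (2*k+1)) = ?X ^ (n^2)" for n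
    by (induction n) (simp_all add: power2_eq_square algebra_simps flip: power_add)
  have "(\<Prod>k<2*N. ?X ^ (2*N) + ?z * ?X * (?X\<^sup>2) ^ k) =
      (\<Prod>k<N. ?X ^ (2*N) + ?z * ?X * (?X\<^sup>2) ^ k) * (\<Prod>k=N..<2*N. ?X ^ (2*N) + ?z * ?X * (?X\<^sup>2) ^ k)"
    by (subst prod.union_disjoint[symmetric]) (auto intro!: prod.cong)
  also have "(\<Prod>k<N. ?X ^ (2*N) + ?z * ?X * (?X\<^sup>2) ^ k) = (\<Prod>k<N. ?z * ?X ^ (2*k+1) * (1 + ?w * ?X ^ (2*(N - Suc k)+1)))"
  proof (intro prod.cong refl)
    fix k assume "k \<in> {..<N}"
    hence "2*N = (2*k+1) + (2*(N - Suc k)+1)" by auto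
    hence e: "?X ^ (2*N) = ?X ^ (2*k+1) * ?X ^ (2*(N - Suc k)+1)" by (metis power_add)
    have "?z * ?X * (?X\<^sup>2) ^ k = ?z * ?X ^ (2*k+1)" by (simp add: power_mult)
    moreover have "?z * ?X ^ (2*k+1) * (1 + ?w * ?X ^ (2*(N - Suc k)+1)) = 
       ?z * ?X ^ (2*k+1) + (?z * ?w) * (?X ^ (2*k+1) * ?X ^ (2*(N - Suc k)+1))"
      by (simp only: distrib_left mult_1_right mult_1_left mult_ac)
    ultimately show "?X ^ (2*N) + ?z * ?X * (?X\<^sup>2) ^ k = ?z * ?X ^ (2*k+1) * (1 + ?w * ?X ^ (2*(N - Suc k)+1))"
      unfolding zw e by (simp only: mult_1_left add.commute)
  qed
  also have "\<dots> = ?z ^ N * ?X ^ (N^2) * (\<Prod>k<N. 1 + ?w * ?X ^ (2*(N - Suc k)+1))"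
    unfolding prod.distrib Xodd by simp
  also have "(\<Prod>k<N. 1 + ?w * ?X ^ (2*(N - Suc k)+1)) = (\<Prod>k<N. 1 + ?w * ?X ^ (2*k+1))"
    by (rule prod.nat_diff_reindex)
  also have "(\<Prod>k=N..<2*N. ?X ^ (2*N) + ?z * ?X * (?X\<^sup>2) ^ k) = (\<Prod>k<N. ?X ^ (2*N) * (1 + ?z * ?X ^ (2*k+1)))"
    by (rule prod.reindex_bij_witness[of _ "\<lambda>k. k + N" "\<lambda>k. k - N"])
       (auto simp: algebra_simps simp flip: power_add power_mult power_Suc intro!: arg_cong[of _ _ "power ?X"])
  also have "\<dots> = ?X ^ (2*N^2) * (\<Prod>k<N. 1 + ?z * ?X ^ (2*k+1))"
    unfolding prod.distrib by (simp add: power2_eq_square algebra_simps flip: power_mult)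
  finally have 1: "(\<Prod>k<2*N. ?X ^ (2*N) + ?z * ?X * (?X\<^sup>2) ^ k) = ?z ^ N * ?X ^ (3*N^2) * ?L"
    unfolding prod.distrib by (simp add: algebra_simps flip: power_add)
  have "(\<Prod>k<2*N. ?X ^ (2*N) + ?z * ?X * (?X\<^sup>2) ^ k) =
      (\<Sum>k\<le>2*N. qbinom (?X\<^sup>2) (2*N) k * (?X\<^sup>2) ^ (k choose 2) * (?z * ?X) ^ k * (?X ^ (2*N)) ^ (2*N - k))"
    by (rule q_binomial_theorem)
  also have "\<dots> = (\<Sum>j = -int N..int N. ?z ^ N * ?X ^ (3*N^2) *
      (fps_const (\<zeta> powi j) * qbinom (?X\<^sup>2) (2*N) (nat (int N + j)) * ?X ^ nat (j\<^sup>2)))"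
  proof (rule sum.reindex_bij_witness[of _ "\<lambda>j. nat (int N + j)" "\<lambda>k. int k - int N"])
    fix k assume "k \<in> {..2*N}"
    hence k: "k \<le> 2*N" by simp
    have "\<zeta> ^ k = \<zeta> ^ N * \<zeta> powi (int k - int N)"
      using assms by (simp add: power_int_diff)
    hence zk: "?z ^ k = ?z ^ N * fps_const (\<zeta> powi (int k - int N))"
      by (simp add: fps_const_power)
    \<comment> \<open>Completing the square: k^2 + 2N(2N-k) = 3N^2 + (k-N)^2, and k - N is the new
      index j.\<close>
    have "2 * (k choose 2) + k = k^2"
      by (induction k) (auto simp: numeral_2_eq_2)
    hence "2 * (k choose 2) + k + 2*N*(2*N-k) = k^2 + 2*N*(2*N-k)" by simp
    also have "\<dots> = 3*N^2 + nat ((int k - int N)^2)"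
    proof -
      have "int (k^2 + 2*N*(2*N-k)) = int (3*N^2 + nat ((int k - int N)^2))"
        unfolding of_nat_add of_nat_mult of_nat_power of_nat_diff[OF k] nat_0_le[OF zero_le_power2]
        by (simp add: power2_eq_square algebra_simps)
      thus ?thesis by linarith
    qed
    finally have e: "2 * (k choose 2) + k + 2*N*(2*N-k) = 3*N^2 + nat ((int k - int N)^2)" .
    have "(?X\<^sup>2) ^ (k choose 2) * (?z * ?X) ^ k * (?X ^ (2*N)) ^ (2*N - k) = 
       ?z ^ k * ?X ^ (2 * (k choose 2) + k + 2*N*(2*N-k))"
      by (simp only: power_mult_distrib power_mult power_add mult_ac)
    hence "(?X\<^sup>2) ^ (k choose 2) * (?z * ?X) ^ k * (?X ^ (2*N)) ^ (2*N - k) = 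
       ?z ^ N * fps_const (\<zeta> powi (int k - int N)) * (?X ^ (3*N^2) * ?X ^ nat ((int k - int N)^2))"
      unfolding e zk power_add .
    thus "?z ^ N * ?X ^ (3*N^2) * (fps_const (\<zeta> powi (int k - int N)) * qbinom (?X\<^sup>2) (2*N) (nat (int N + (int k - int N)))
        * ?X ^ nat ((int k - int N)\<^sup>2)) = 
       qbinom (?X\<^sup>2) (2*N) k * (?X\<^sup>2) ^ (k choose 2) * (?z * ?X) ^ k * (?X ^ (2*N)) ^ (2*N - k)"
      by (simp add: mult_ac)
  qed auto
  finally have "?z ^ N * ?X ^ (3*N^2) * ?L = ?z ^ N * ?X ^ (3*N^2) * 
     (\<Sum>j = -int N..int N. fps_const (\<zeta> powi j) * qbinom (?X\<^sup>2) (2*N) (nat (int N + j)) * ?X ^ nat (j\<^sup>2))"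
    unfolding 1 sum_distrib_left .
  moreover have "?z ^ N * ?X ^ (3*N^2) \<noteq> 0"
    using assms by simp
  ultimately show ?thesis
    using mult_left_cancel by blast
qed

lemma qfact_fps_nth_0 [simp]:
  "0 < e \<Longrightarrow> fps_nth (qfact (fps_X ^ e :: 'a::comm_ring_1 fps) n) 0 = 1"
  by (induction n) (simp_all add: qfact_Suc flip: power_mult power_Suc power_add)

text \<open>The extra factors 1 - X^(e(i+1)) with i \<ge> m equal 1 up to degree d.\<close>

lemma qfact_eq_upto:
  assumes "m \<le> n" and "d < e * Suc m"
  shows "fps_eq_upto d (qfact (fps_X ^ e) n) (qfact (fps_X ^ e :: 'a::comm_ring_1 fps) m)"
  using assms(1)
proof (induction n rule: dec_induct)
  case (step n)
  have "e * Suc m \<le> e * Suc n" using step by (intro mult_left_mono) auto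
  hence "fps_eq_upto d (1 + fps_X ^ (e * Suc n) * (-1)) (1 :: 'a fps)"
    using assms(2) by (intro fps_eq_upto_add_X_power) linarith
  hence "fps_eq_upto d (1 - (fps_X ^ e) ^ Suc n) (1 :: 'a fps)"
    by (simp only: power_mult) simp
  from fps_eq_upto_mult[OF step.IH this] show ?case by (simp add: qfact_Suc)
qed simp

section \<open>Truncated theta functions\<close>

text \<open>The series \<theta>(\<zeta>) cut to |j| \<le> N; it is exact in all degrees below
  (N+1)^2.\<close>

definition theta :: "nat \<Rightarrow> 'a::field \<Rightarrow> 'a fps" where
  "theta N \<zeta> = (\<Sum>j = -int N..int N. fps_const (\<zeta> powi j) * fps_X ^ nat (j\<^sup>2))"

text \<open>With m = N - |j|, the q-binomial times \<open>qfact\<close> is 1 up to degree 2m+1. The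
  factor X^(j^2) raises this precision to 2m+1+j^2, which is at least 2N because (|j|-1)^2 \<ge>
  0.\<close>

lemma qbinom_central_eq_upto:
  assumes "\<bar>j\<bar> \<le> int N"
  shows "fps_eq_upto (2*N) (qbinom (fps_X\<^sup>2) (2*N) (nat (int N + j)) * fps_X ^ nat (j\<^sup>2) * qfact (fps_X\<^sup>2) N)
           (fps_X ^ nat (j\<^sup>2) :: 'a::field fps)"
proof -
  let ?Q = "fps_X\<^sup>2 :: 'a fps"
  define m where "m = N - nat \<bar>j\<bar>"
  define k where "k = nat (int N + j)"
  define B where "B = qbinom ?Q (2*N) k"
  have k: "k \<le> 2*N" "m \<le> k" "m \<le> 2*N - k" "m \<le> N" "m \<le> 2 * N"
    using assms unfolding k_def m_def by auto
  have E: "fps_eq_upto (2*m+1) (qfact ?Q n) (qfact ?Q m)" if "m \<le> n" for n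
    using that by (intro qfact_eq_upto) auto
  \<comment> \<open>To this degree \<open>qfact ?Q\<close> takes the same value at \<open>k\<close>,
    \<open>2*N - k\<close>, \<open>2*N\<close> and \<open>m\<close>, so the quotient formula equates
    \<open>B * qfact ?Q m * qfact ?Q m\<close> with \<open>qfact ?Q m\<close>, and one factor
    cancels.\<close>
  have "fps_eq_upto (2*m+1) (B * qfact ?Q m * qfact ?Q m) (B * qfact ?Q k * qfact ?Q (2*N - k))"
    using k by (intro fps_eq_upto_mult fps_eq_upto_refl fps_eq_upto_sym[OF E])
  also have "B * qfact ?Q k * qfact ?Q (2*N - k) = qfact ?Q (2*N)"
    unfolding B_def by (intro qbinom_qfact k)
  also have "fps_eq_upto (2*m+1) \<dots> (1 * qfact ?Q m)"
    using E k by simp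
  finally have "fps_eq_upto (2*m+1) (B * qfact ?Q m) 1"
    by (rule fps_eq_upto_cancel) simp
  moreover have "fps_eq_upto (2*m+1) (B * qfact ?Q N) (B * qfact ?Q m)"
    using k by (intro fps_eq_upto_mult fps_eq_upto_refl E)
  ultimately have "fps_eq_upto (2*m+1) (B * qfact ?Q N) 1"
    using fps_eq_upto_trans by blast
  moreover have "2*N \<le> 2*m+1 + nat (j\<^sup>2)"
  proof -
    have "0 \<le> (\<bar>j\<bar> - 1)\<^sup>2" by simp
    hence "2 * \<bar>j\<bar> \<le> j\<^sup>2 + 1" by (simp add: power2_eq_square algebra_simps)
    moreover have "int (nat (j\<^sup>2)) = j\<^sup>2" by simp
    ultimately show ?thesis using assms unfolding m_def by linarith
  qed
  ultimately have "fps_eq_upto (2*N) (fps_X ^ nat (j\<^sup>2) * (B * qfact ?Q N)) (fps_X ^ nat (j\<^sup>2) * 1)"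
    by (rule fps_eq_upto_X_power_mult)
  thus ?thesis unfolding B_def k_def by (simp add: mult_ac)
qed

text \<open>Multiplying the finite identity by \<open>qfact (fps_X\<^sup>2) N\<close> turns each of
  its q-binomials into 1, to the stated precision.\<close>

lemma jacobi_triple_product_upto:
  fixes \<zeta> :: "'a::field"
  assumes "\<zeta> \<noteq> 0"
  shows "fps_eq_upto (2*N)
    ((\<Prod>k<N. (1 + fps_const \<zeta> * fps_X ^ (2*k+1)) * (1 + fps_const (inverse \<zeta>) * fps_X ^ (2*k+1)))
       * qfact (fps_X\<^sup>2) N) (theta N \<zeta>)"
proof -
  have "fps_eq_upto (2*N) (\<Sum>j = -int N..int N. fps_const (\<zeta> powi j) *
     (qbinom (fps_X\<^sup>2) (2*N) (nat (int N + j)) * fps_X ^ nat (j\<^sup>2) * qfact (fps_X\<^sup>2) N)) (theta N \<zeta>)"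
    unfolding theta_def
    by (intro fps_eq_upto_sum fps_eq_upto_mult fps_eq_upto_refl qbinom_central_eq_upto) auto
  thus ?thesis
    unfolding finite_jacobi_triple_product[OF assms] sum_distrib_right by (simp only: mult_ac)
qed

section \<open>Products of two theta functions and sums of two squares\<close>

lemma theta_product_nth:
  "fps_nth (theta N \<zeta> * theta N \<xi>) n = 
    (\<Sum>(m, l) | (m, l) \<in> {-int N..int N} \<times> {-int N..int N} \<and> m\<^sup>2 + l\<^sup>2 = int n. \<zeta> powi m * \<xi> powi l)"
proof -
  have eq: "fps_const a * fps_X ^ nat (m\<^sup>2) * (fps_const b * fps_X ^ nat (l\<^sup>2)) =
      fps_const (a * b) * fps_X ^ nat (m\<^sup>2 + l\<^sup>2)" for a b :: 'a and m l
    by (simp add: nat_add_distrib power_add mult_ac flip: fps_const_mult)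
  have n: "n = nat (m\<^sup>2 + l\<^sup>2) \<longleftrightarrow> m\<^sup>2 + l\<^sup>2 = int n" for m l :: int
    by (metis add_nonneg_nonneg nat_int int_nat_eq zero_le_power2)
  have "fps_nth (theta N \<zeta> * theta N \<xi>) n = 
    (\<Sum>m = -int N..int N. \<Sum>l = -int N..int N. if m\<^sup>2 + l\<^sup>2 = int n then \<zeta> powi m * \<xi> powi l else 0)"
    unfolding theta_def sum_product eq fps_sum_nth
    by (intro sum.cong refl) (simp add: n)
  also have "\<dots> = (\<Sum>(m, l)\<in>{-int N..int N} \<times> {-int N..int N}. if m\<^sup>2 + l\<^sup>2 = int n then \<zeta> powi m * \<xi> powi l else 0)"
    by (rule sum.cartesian_product)
  also have "\<dots> = (\<Sum>a\<in>{-int N..int N} \<times> {-int N..int N}. if (case a of (m, l) \<Rightarrow> m\<^sup>2 + l\<^sup>2 = int n) then (case a of (m, l) \<Rightarrow> \<zeta> powi m * \<xi> powi l) else 0)"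
    by (intro sum.cong) auto
  also have "\<dots> = (\<Sum>(m, l)\<in>{a \<in> {-int N..int N} \<times> {-int N..int N}. case a of (m, l) \<Rightarrow> m\<^sup>2 + l\<^sup>2 = int n}. \<zeta> powi m * \<xi> powi l)"
    by (rule sum.inter_filter[symmetric]) simp
  finally show ?thesis by (simp add: case_prod_unfold mem_Times_iff)
qed

text \<open>Integers satisfy |m| \<le> m^2. This keeps representations by two squares inside the
  truncation range of \<open>theta\<close>.\<close>

lemma abs_le_of_square_le: "m\<^sup>2 \<le> int n \<Longrightarrow> \<bar>m\<bar> \<le> int n"
proof -
  assume "m\<^sup>2 \<le> int n"
  moreover have "\<bar>m\<bar> \<le> m\<^sup>2"
    using mult_right_mono[of 1 "\<bar>m\<bar>" "\<bar>m\<bar>"] by (cases "m = 0") (auto simp: power2_eq_square)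
  ultimately show ?thesis by linarith
qed

text \<open>If m^2 + l^2 is even, then m and l have equal parity, so m = r + s and l = r - s with
  integers r, s, and \<zeta>^m \<xi>^l = (\<zeta>\<xi>)^r (\<zeta>/\<xi>)^s. The bound
  \<open>2 * n \<le> N\<close> ensures that the truncation loses no pairs.\<close>

lemma theta_product_even_nth:
  fixes \<zeta> \<xi> :: "'a::field"
  assumes "\<zeta> \<noteq> 0" "\<xi> \<noteq> 0" "2 * n \<le> N"
  shows "fps_nth (theta N \<zeta> * theta N \<xi>) (2 * n) = fps_nth (theta N (\<zeta> * \<xi>) * theta N (\<zeta> / \<xi>)) n"
  unfolding theta_product_nth
proof (rule sum.reindex_bij_witness[of _ "\<lambda>(r, s). (r + s, r - s)" "\<lambda>(m, l). ((m + l) div 2, (m - l) div 2)"])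
  fix a assume a: "a \<in> {(m, l). (m, l) \<in> {-int N..int N} \<times> {-int N..int N} \<and> m\<^sup>2 + l\<^sup>2 = int (2 * n)}"
  obtain m l where ml: "a = (m, l)" by (cases a)
  have sq: "m\<^sup>2 + l\<^sup>2 = 2 * int n" using a ml by simp
  hence "even (m\<^sup>2 + l\<^sup>2)" by simp
  hence "even (m + l)" by simp
  then obtain r where r: "m + l = 2 * r" by (elim evenE)
  define s where "s = m - r"
  have m: "m = r + s" and l: "l = r - s" using r by (auto simp: s_def)
  have rs: "r\<^sup>2 + s\<^sup>2 = int n" using sq unfolding m l by (simp add: power2_eq_square algebra_simps)
  have "\<bar>r\<bar> \<le> int n" "\<bar>s\<bar> \<le> int n"
    by (intro abs_le_of_square_le; use rs in \<open>simp flip: rs\<close>)+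
  moreover have d: "(case a of (m, l) \<Rightarrow> ((m + l) div 2, (m - l) div 2)) = (r, s)"
    unfolding ml m l by simp
  ultimately show "(case a of (m, l) \<Rightarrow> ((m + l) div 2, (m - l) div 2)) \<in>
     {(m, l). (m, l) \<in> {-int N..int N} \<times> {-int N..int N} \<and> m\<^sup>2 + l\<^sup>2 = int n}"
    using rs assms(3) unfolding d by auto
  show "(case case a of (m, l) \<Rightarrow> ((m + l) div 2, (m - l) div 2) of (r, s) \<Rightarrow> (r + s, r - s)) = a"
    unfolding d by (simp add: ml m l)
  show "(case case a of (m, l) \<Rightarrow> ((m + l) div 2, (m - l) div 2) of (m, l) \<Rightarrow> (\<zeta> * \<xi>) powi m * (\<zeta> / \<xi>) powi l)
      = (case a of (m, l) \<Rightarrow> \<zeta> powi m * \<xi> powi l)"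
    unfolding d ml m l using assms
    by (simp add: power_int_mult_distrib power_int_divide_distrib power_int_add power_int_diff)
next
  fix b assume b: "b \<in> {(m, l). (m, l) \<in> {-int N..int N} \<times> {-int N..int N} \<and> m\<^sup>2 + l\<^sup>2 = int n}"
  obtain r s where rs: "b = (r, s)" by (cases b)
  have sq: "r\<^sup>2 + s\<^sup>2 = int n" using b rs by simp
  hence sq': "(r + s)\<^sup>2 + (r - s)\<^sup>2 = int (2 * n)" by (simp add: power2_eq_square algebra_simps)
  have "\<bar>r + s\<bar> \<le> int (2 * n)" "\<bar>r - s\<bar> \<le> int (2 * n)"
    by (intro abs_le_of_square_le; simp only: sq'[symmetric]; simp)+
  thus "(case b of (r, s) \<Rightarrow> (r + s, r - s)) \<in> 
    {(m, l). (m, l) \<in> {-int N..int N} \<times> {-int N..int N} \<and> m\<^sup>2 + l\<^sup>2 = int (2 * n)}"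
    using sq' assms(3) unfolding rs by auto
qed auto

section \<open>PDO partitions with bounded parts and multiplicities\<close>

definition mset_box :: "nat set \<Rightarrow> nat \<Rightarrow> nat multiset set" where
  "mset_box S L = {M. set_mset M \<subseteq> S \<and> (\<forall>p. count M p \<le> L)}"

lemma bij_betw_mset_box:
  assumes "finite S"
  shows "bij_betw (\<lambda>M. restrict (count M) S) (mset_box S L) (\<Pi>\<^sub>E p\<in>S. {..L})"
proof (rule bij_betw_byWitness[where f' = "\<lambda>f. \<Sum>p\<in>S. replicate_mset (f p) p"])
  have c: "count (\<Sum>p\<in>S. replicate_mset (f p) p) q = (if q \<in> S then f q else 0)" for f q
    using assms by (simp add: count_sum)
  show "\<forall>M\<in>mset_box S L. (\<Sum>p\<in>S. replicate_mset (restrict (count M) S p) p) = M"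
    by (auto simp: mset_box_def multiset_eq_iff c count_eq_zero_iff)
  show "\<forall>f\<in>\<Pi>\<^sub>E p\<in>S. {..L}. restrict (count (\<Sum>p\<in>S. replicate_mset (f p) p)) S = f"
    by (auto simp: c fun_eq_iff PiE_def extensional_def)
  show "(\<lambda>M. restrict (count M) S) ` mset_box S L \<subseteq> (\<Pi>\<^sub>E p\<in>S. {..L})"
    by (auto simp: mset_box_def)
  have "p \<in> S" if "p \<in># (\<Sum>p\<in>S. replicate_mset (f p) p)" for p f
    using that unfolding count_greater_zero_iff[symmetric] c by (auto split: if_splits)
  thus "(\<lambda>f. \<Sum>p\<in>S. replicate_mset (f p) p) ` (\<Pi>\<^sub>E p\<in>S. {..L}) \<subseteq> mset_box S L"
    unfolding mset_box_def by (auto simp: c)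
qed

lemma finite_mset_box: "finite S \<Longrightarrow> finite (mset_box S L)"
  using bij_betw_finite[OF bij_betw_mset_box] by (simp add: finite_PiE)

text \<open>Distributivity: picking a summand \<open>t\<close> for every \<open>p\<close> amounts to
  picking a multiset with these multiplicities.\<close>

lemma sum_mset_box:
  assumes "finite S"
  shows "(\<Sum>M\<in>mset_box S L. \<Prod>p\<in>S. g p (count M p)) =
           (\<Prod>p\<in>S. \<Sum>t\<le>L. g p t :: 'a::comm_semiring_1)"
proof -
  have "(\<Sum>M\<in>mset_box S L. \<Prod>p\<in>S. g p (count M p)) =
          (\<Sum>M\<in>mset_box S L. \<Prod>p\<in>S. g p (restrict (count M) S p))"
    by simp
  also have "\<dots> = (\<Sum>f\<in>(\<Pi>\<^sub>E p\<in>S. {..L}). \<Prod>p\<in>S. g p (f p))"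
    by (rule sum.reindex_bij_betw[OF bij_betw_mset_box[OF assms]])
  also have "\<dots> = (\<Prod>p\<in>S. \<Sum>t\<le>L. g p t)"
    using assms by (simp add: prod_sum_PiE)
  finally show ?thesis .
qed

lemma sum_mset_box_pair:
  assumes "finite S"
  shows "(\<Sum>M\<in>mset_box S L. \<Sum>N\<in>mset_box S L. \<Prod>p\<in>S. g p (count M p) (count N p)) =
           (\<Prod>p\<in>S. \<Sum>s\<le>L. \<Sum>t\<le>L. g p s t :: 'a::comm_semiring_1)"
proof -
  have "(\<Sum>N\<in>mset_box S L. \<Prod>p\<in>S. g p (count M p) (count N p)) =
      (\<Prod>p\<in>S. \<Sum>t\<le>L. g p (count M p) t)" for M
    using sum_mset_box[OF assms, of "\<lambda>p. g p (count M p)"] .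
  thus ?thesis
    using sum_mset_box[OF assms, of "\<lambda>p s. \<Sum>t\<le>L. g p s t" L] by simp
qed

definition PDO_box :: "nat set \<Rightarrow> nat \<Rightarrow> pdo set" where
  "PDO_box S L = {\<rho> \<in> PDO. fst \<rho> \<in> mset_box S L}"

lemma PDO_box_conv_Sigma:
  assumes "\<forall>p\<in>S. odd p"
  shows "PDO_box S L = (SIGMA M : mset_box S L. \<Pi>\<^sub>E p\<in>set_mset M. {1..count M p})"
  using assms by (auto simp: PDO_box_def PDO_def mset_box_def)

lemma finite_PDO_box: "finite S \<Longrightarrow> \<forall>p\<in>S. odd p \<Longrightarrow> finite (PDO_box S L)"
  by (simp add: PDO_box_conv_Sigma finite_mset_box finite_PiE)

text \<open>The designated occurrences are chosen independently for each part size, and the summand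
  does not depend on the choice.\<close>

lemma sum_PDO_box:
  fixes h :: "nat multiset \<Rightarrow> 'a::comm_semiring_1"
  assumes "finite S" "\<forall>p\<in>S. odd p"
  shows "(\<Sum>\<rho>\<in>PDO_box S L. h (fst \<rho>)) =
           (\<Sum>M\<in>mset_box S L. of_nat (\<Prod>p\<in>set_mset M. count M p) * h M)"
proof -
  have "(\<Sum>\<rho>\<in>PDO_box S L. h (fst \<rho>)) =
     (\<Sum>M\<in>mset_box S L. \<Sum>d\<in>(\<Pi>\<^sub>E p\<in>set_mset M. {1..count M p}). h M)"
    unfolding PDO_box_conv_Sigma[OF assms(2)] case_prod_unfold
    by (subst sum.Sigma) (use assms in \<open>auto simp: finite_mset_box finite_PiE case_prod_unfold\<close>)
  also have "\<dots> = (\<Sum>M\<in>mset_box S L. of_nat (\<Prod>p\<in>set_mset M. count M p) * h M)"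
    by (simp add: card_PiE)
  finally show ?thesis .
qed

section \<open>Weights as products over part sizes\<close>

lemma power_card_eq_prod:
  fixes x :: "'a::comm_semiring_1"
  assumes "finite S" "A \<subseteq> S"
  shows "x ^ card A = (\<Prod>p\<in>S. if p \<in> A then x else 1)"
proof -
  have "(\<Prod>p\<in>S. if p \<in> A then x else 1) = (\<Prod>p\<in>A. x)"
    using assms by (intro prod.mono_neutral_cong_right) auto
  thus ?thesis by simp
qed

lemma power_sum_mset_eq_prod:
  fixes q :: "'a::comm_semiring_1"
  assumes "finite S" "set_mset M \<subseteq> S"
  shows "q ^ sum_mset M = (\<Prod>p\<in>S. (q ^ p) ^ count M p)"
proof -
  have "sum_mset M = (\<Sum>p\<in>S. p * count M p)"
    using assms(2)
  proof (induction M)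
    case (add x M)
    have "p * count (add_mset x M) p = p * count M p + (if p = x then p else 0)" for p
      by simp
    thus ?case using add assms(1) by (simp add: sum.distrib)
  qed simp
  thus ?thesis
    by (simp add: power_sum power_mult)
qed

lemma of_nat_prod_count_eq_prod:
  assumes "finite S" "set_mset M \<subseteq> S"
  shows "of_nat (\<Prod>p\<in>set_mset M. count M p) =
           (\<Prod>p\<in>S. if p \<in># M then of_nat (count M p) else 1 :: 'a::comm_semiring_1)"
  unfolding of_nat_prod using assms by (intro prod.mono_neutral_cong_left) auto

text \<open>Contribution of one part size p with multiplicity \<open>t\<close>, where z = q^p. The
  factor \<open>t\<close> counts the positions of the designated occurrence; an absent part size
  contributes 1.\<close>

definition pdo_term :: "'a::comm_semiring_1 \<Rightarrow> 'a \<Rightarrow> 'a \<Rightarrow> nat \<Rightarrow> 'a" where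
  "pdo_term x y z t = (if t = 0 then 1 else of_nat t * x * (if odd t then y else 1) * z ^ t)"

lemma sum_PDO_box_eq_prod:
  fixes x y q :: "'a::comm_semiring_1"
  assumes "finite S" "\<forall>p\<in>S. odd p"
  shows "(\<Sum>\<rho>\<in>PDO_box S L. x ^ ell_d \<rho> * y ^ ell_do \<rho> * q ^ weight \<rho>) =
           (\<Prod>p\<in>S. \<Sum>t\<le>L. pdo_term x y (q ^ p) t)"
proof -
  let ?h = "\<lambda>M. x ^ card (set_mset M) * y ^ card {p \<in> set_mset M. odd (count M p)} * q ^ sum_mset M"
  have "(\<Sum>\<rho>\<in>PDO_box S L. x ^ ell_d \<rho> * y ^ ell_do \<rho> * q ^ weight \<rho>) =
      (\<Sum>M\<in>mset_box S L. of_nat (\<Prod>p\<in>set_mset M. count M p) * ?h M)"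
    unfolding ell_d_def ell_do_def weight_def by (rule sum_PDO_box[OF assms])
  also have "\<dots> = (\<Sum>M\<in>mset_box S L. \<Prod>p\<in>S. pdo_term x y (q ^ p) (count M p))"
  proof (intro sum.cong refl)
    fix M assume "M \<in> mset_box S L"
    hence M: "set_mset M \<subseteq> S" by (simp add: mset_box_def)
    hence sub: "{p \<in> set_mset M. odd (count M p)} \<subseteq> S" by blast
    show "of_nat (\<Prod>p\<in>set_mset M. count M p) * ?h M = (\<Prod>p\<in>S. pdo_term x y (q ^ p) (count M p))"
      unfolding power_card_eq_prod[OF assms(1) M] power_card_eq_prod[OF assms(1) sub]
        power_sum_mset_eq_prod[OF assms(1) M] of_nat_prod_count_eq_prod[OF assms(1) M] prod.distrib[symmetric]
      by (intro prod.cong refl) (auto simp: pdo_term_def mult.assoc simp flip: count_greater_zero_iff)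
  qed
  also have "\<dots> = (\<Prod>p\<in>S. \<Sum>t\<le>L. pdo_term x y (q ^ p) t)"
    by (rule sum_mset_box[OF assms(1)])
  finally show ?thesis .
qed

text \<open>Contribution of one part size with multiplicities \<open>s\<close> in \<mu> and
  \<open>t\<close> in \<nu>; the last factor records whether it is common to both.\<close>

definition pdo_pair_term :: "'a::comm_semiring_1 \<Rightarrow> 'a \<Rightarrow> 'a \<Rightarrow> nat \<Rightarrow> nat \<Rightarrow> 'a" where
  "pdo_pair_term x y z s t =
     (if s = 0 then 1 else of_nat s * x * z ^ s) * (if t = 0 then 1 else of_nat t * x * z ^ t)
     * (if s \<noteq> 0 \<and> t \<noteq> 0 then y\<^sup>2 else 1)"

lemma sum_PDO_box_pair_eq_prod:
  fixes x y q :: "'a::comm_semiring_1"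
  assumes "finite S" "\<forall>p\<in>S. odd p"
  shows "(\<Sum>\<mu>\<in>PDO_box S L. \<Sum>\<nu>\<in>PDO_box S L.
             x ^ (ell_d \<mu> + ell_d \<nu>) * y ^ (2 * ell_r \<mu> \<nu>) * q ^ (weight \<mu> + weight \<nu>)) =
           (\<Prod>p\<in>S. \<Sum>s\<le>L. \<Sum>t\<le>L. pdo_pair_term x y (q ^ p) s t)"
proof -
  let ?h = "\<lambda>M N. x ^ (card (set_mset M) + card (set_mset N)) * y ^ (2 * card (set_mset M \<inter> set_mset N))
     * q ^ (sum_mset M + sum_mset N)"
  let ?c = "\<lambda>M. of_nat (\<Prod>p\<in>set_mset M. count M p)"
  have "(\<Sum>\<nu>\<in>PDO_box S L.
             x ^ (ell_d \<mu> + ell_d \<nu>) * y ^ (2 * ell_r \<mu> \<nu>) * q ^ (weight \<mu> + weight \<nu>)) =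
      (\<Sum>N\<in>mset_box S L. ?c N * ?h (fst \<mu>) N)" for \<mu>
    unfolding ell_d_def ell_r_def weight_def by (rule sum_PDO_box[OF assms])
  hence "(\<Sum>\<mu>\<in>PDO_box S L. \<Sum>\<nu>\<in>PDO_box S L.
             x ^ (ell_d \<mu> + ell_d \<nu>) * y ^ (2 * ell_r \<mu> \<nu>) * q ^ (weight \<mu> + weight \<nu>)) =
      (\<Sum>M\<in>mset_box S L. ?c M * (\<Sum>N\<in>mset_box S L. ?c N * ?h M N))"
    using sum_PDO_box[OF assms, of "\<lambda>M. \<Sum>N\<in>mset_box S L. ?c N * ?h M N" L] by simp
  also have "\<dots> = (\<Sum>M\<in>mset_box S L. \<Sum>N\<in>mset_box S L.
      \<Prod>p\<in>S. pdo_pair_term x y (q ^ p) (count M p) (count N p))"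
    unfolding sum_distrib_left
  proof (intro sum.cong refl)
    fix M N assume "M \<in> mset_box S L" "N \<in> mset_box S L"
    hence M: "set_mset M \<subseteq> S" and N: "set_mset N \<subseteq> S" by (simp_all add: mset_box_def)
    hence sub: "set_mset M \<inter> set_mset N \<subseteq> S" by blast
    show "?c M * (?c N * ?h M N) = (\<Prod>p\<in>S. pdo_pair_term x y (q ^ p) (count M p) (count N p))"
      unfolding power_add power_mult power_card_eq_prod[OF assms(1) M] power_card_eq_prod[OF assms(1) N] power_card_eq_prod[OF assms(1) sub]
        power_sum_mset_eq_prod[OF assms(1) M] of_nat_prod_count_eq_prod[OF assms(1) M]
        power_sum_mset_eq_prod[OF assms(1) N] of_nat_prod_count_eq_prod[OF assms(1) N] prod.distrib[symmetric]
      by (intro prod.cong refl) (auto simp: pdo_pair_term_def mult_ac simp flip: count_greater_zero_iff)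
  qed
  also have "\<dots> = (\<Prod>p\<in>S. \<Sum>s\<le>L. \<Sum>t\<le>L. pdo_pair_term x y (q ^ p) s t)"
    by (rule sum_mset_box_pair[OF assms(1)])
  finally show ?thesis .
qed

section \<open>Local factors\<close>

text \<open>The sum of t z^t is z(1+z^2)/(1-z^2)^2 over odd t and 2z^2/(1-z^2)^2 over even t. The
  last summand is the exact truncation error, divisible by z^(2L+1). With the even bound each
  induction step adds one odd and one even term.\<close>

lemma sum_pdo_term:
  fixes x y z :: "'a::comm_ring_1"
  shows "(\<Sum>t\<le>2*L. pdo_term x y z t) * (1 - z\<^sup>2)\<^sup>2 =
    (1 - z\<^sup>2)\<^sup>2 + x * y * z * (1 + z\<^sup>2) + 2 * x * z\<^sup>2 
    + z ^ (2*L+1) * - (x * (y * (of_nat (2*L+1) - (of_nat (2*L) - 1) * z\<^sup>2) + z * (of_nat (2*L+2) - of_nat (2*L) * z\<^sup>2)))"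
proof (induction L)
  case 0
  show ?case by (simp add: pdo_term_def power2_eq_square algebra_simps)
next
  case (Suc L)
  have s: "(\<Sum>t\<le>2 * Suc L. pdo_term x y z t) = (\<Sum>t\<le>2*L. pdo_term x y z t)
      + (of_nat (2*L) + 1) * x * y * z ^ (2*L+1) + (of_nat (2*L) + 2) * x * (z * z ^ (2*L+1))"
    by (simp add: pdo_term_def algebra_simps)
  have e: "z ^ (2 * Suc L + 1) = z\<^sup>2 * z ^ (2*L+1)" by (simp add: power2_eq_square)
  define w where "w = z ^ (2*L+1)"
  define k :: 'a where "k = of_nat (2*L)"
  have k: "of_nat (2 * L + 1) = k + 1" "of_nat (2 * L + 2) = k + 2" "of_nat (2 * Suc L) = k + 2"
     "of_nat (2 * Suc L + 1) = k + 3" "of_nat (2 * Suc L + 2) = k + 4"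
    by (simp_all add: k_def)
  show ?case
    unfolding s e distrib_right[of _ _ "(1 - z\<^sup>2)\<^sup>2"] Suc.IH
    unfolding k k_def[symmetric] w_def[symmetric] by (simp add: power2_eq_square algebra_simps)
qed

text \<open>Truncation of z/(1-z)^2 = \<Sum> t z^t, with an explicit error divisible by
  z^(L+1).\<close>

lemma sum_of_nat_mult_power:
  fixes z :: "'a::comm_ring_1"
  shows "(\<Sum>t\<le>L. of_nat t * z ^ t) * (1 - z)\<^sup>2 = z + z ^ (L + 1) * - (of_nat (L + 1) - of_nat L * z)"
  by (induction L) (simp_all add: power2_eq_square algebra_simps)

text \<open>The three terms come from a part size lying in neither, exactly one, or both of the
  partitions.\<close>

lemma sum_pdo_pair_term:
  fixes x y z :: "'a::comm_ring_1"
  defines "T \<equiv> \<lambda>L. \<Sum>t\<le>L. of_nat t * z ^ t"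
  shows "(\<Sum>s\<le>L. \<Sum>t\<le>L. pdo_pair_term x y z s t) = 1 + 2 * x * T L + x\<^sup>2 * y\<^sup>2 * (T L)\<^sup>2"
proof -
  have T: "T L = (\<Sum>t=1..L. of_nat t * z ^ t)"
    unfolding T_def by (rule sum.mono_neutral_right) (auto simp: not_le)
  have *: "(\<Sum>s\<le>L. f s) = f 0 + (\<Sum>s=1..L. f s)" for f :: "nat \<Rightarrow> 'a"
    by (simp add: sum.atLeast1_atMost_eq sum.atMost_shift)
  have "(\<Sum>s\<le>L. \<Sum>t\<le>L. pdo_pair_term x y z s t) =
      1 + (\<Sum>t=1..L. x * (of_nat t * z ^ t)) + ((\<Sum>s=1..L. x * (of_nat s * z ^ s))
       + (\<Sum>s=1..L. \<Sum>t=1..L. x\<^sup>2 * y\<^sup>2 * ((of_nat s * z ^ s) * (of_nat t * z ^ t))))"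
    unfolding * sum.distrib[symmetric]
    by (intro arg_cong2[of _ _ _ _ plus] sum.cong refl)
       (auto simp: pdo_pair_term_def mult_ac power2_eq_square)
  also have "\<dots> = 1 + 2 * x * T L + x\<^sup>2 * y\<^sup>2 * (T L)\<^sup>2"
    unfolding T power2_eq_square[of "sum _ _"] sum_product by (simp add: sum_distrib_left mult_ac)
  finally show ?thesis .
qed

section \<open>Even parts and factorization of the numerators\<close>

text \<open>The operator U_2 known from modular forms.\<close>

definition fps_even_part :: "'a::comm_ring_1 fps \<Rightarrow> 'a fps" where
  "fps_even_part f = Abs_fps (\<lambda>n. fps_nth f (2 * n))"

lemma fps_even_part_nth [simp]: "fps_nth (fps_even_part f) n = fps_nth f (2 * n)"
  by (simp add: fps_even_part_def)

text \<open>A factor in X^2 passes through the extraction of even coefficients, with X^2 replaced by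
  X.\<close>

lemma fps_even_part_mult_one_minus_X_power:
  "fps_even_part (f * (1 - fps_X ^ (2 * k))) = fps_even_part f * (1 - fps_X ^ k)"
  by (rule fps_ext)
     (auto simp: right_diff_distrib fps_X_power_mult_right_nth simp flip: right_diff_distrib' )

lemma fps_even_part_mult_prod:
  "fps_even_part (f * (\<Prod>i\<in>I. 1 - fps_X ^ (2 * e i))) = fps_even_part f * (\<Prod>i\<in>I. 1 - fps_X ^ e i)"
proof (induction I arbitrary: f rule: infinite_finite_induct)
  case (insert i I)
  have eq: "f * (\<Prod>i\<in>insert i I. 1 - fps_X ^ (2 * e i)) =
      f * (1 - fps_X ^ (2 * e i)) * (\<Prod>i\<in>I. 1 - fps_X ^ (2 * e i))"
    using insert.hyps by (simp add: mult.assoc)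
  show ?case
    unfolding eq insert.IH fps_even_part_mult_one_minus_X_power
    using insert.hyps by (simp add: mult.assoc)
qed simp_all

text \<open>Odd and even exponents together fill 1, ..., 2n. This matches the Euler products of the
  two sides at the end.\<close>

lemma prod_one_minus_X_odd_mult_qfact:
  "(\<Prod>k<n. 1 - fps_X ^ (2*k+1)) * qfact (fps_X\<^sup>2) n = qfact (fps_X :: 'a::comm_ring_1 fps) (2*n)"
proof (induction n)
  case (Suc n)
  have "2 * Suc n = Suc (Suc (2 * n))" by simp
  moreover have "((fps_X :: 'a fps)\<^sup>2) ^ Suc n = fps_X ^ Suc (Suc (2*n))"
    by (simp only: power_mult[symmetric] mult_Suc_right add_2_eq_Suc)
  ultimately show ?case
    using Suc.IH by (simp only: qfact_Suc prod.lessThan_Suc Suc_eq_plus1[symmetric] flip: Suc.IH) (simp only: mult_ac)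
qed simp

section \<open>Quartic numerators as products of reciprocal linear factors\<close>

lemma reciprocal_linear_factors:
  fixes z :: "'a::comm_ring_1"
  assumes "u * u' = 1"
  shows "(1 + u * z) * (1 + u' * z) = 1 + (u + u') * z + z\<^sup>2"
proof -
  have "(1 + u * z) * (1 + u' * z) = 1 + (u + u') * z + (u * u') * z\<^sup>2"
    by (simp add: power2_eq_square algebra_simps)
  thus ?thesis by (simp add: assms)
qed

text \<open>Both sides are palindromic quartics in z, so it suffices to compare the coefficients of
  z and z^2. The inverses are separate variables so that constant power series can be
  substituted.\<close>

lemma pdo_numerator_factorization:
  fixes x y z \<zeta> \<zeta>' \<xi> \<xi>' :: "'a::comm_ring_1"
  assumes inv: "\<zeta> * \<zeta>' = 1" "\<xi> * \<xi>' = 1"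
    and sum: "(\<zeta> + \<zeta>') + (\<xi> + \<xi>') = x * y" and prod: "(\<zeta> + \<zeta>') * (\<xi> + \<xi>') = 2 * x - 4"
  shows "(1 - z\<^sup>2)\<^sup>2 + x * y * z * (1 + z\<^sup>2) + 2 * x * z\<^sup>2 =
           (1 + \<zeta> * z) * (1 + \<zeta>' * z) * ((1 + \<xi> * z) * (1 + \<xi>' * z))"
proof -
  have "(1 + a * z + z\<^sup>2) * (1 + b * z + z\<^sup>2) = 1 + (a + b) * (z + z * z\<^sup>2) + (2 + a * b) * z\<^sup>2 + z\<^sup>2 * z\<^sup>2"
    for a b by (simp add: power2_eq_square algebra_simps)
  hence "(1 + \<zeta> * z) * (1 + \<zeta>' * z) * ((1 + \<xi> * z) * (1 + \<xi>' * z)) =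
      1 + (x * y) * (z + z * z\<^sup>2) + (2 + (2 * x - 4)) * z\<^sup>2 + z\<^sup>2 * z\<^sup>2"
    by (simp only: reciprocal_linear_factors[OF inv(1)] reciprocal_linear_factors[OF inv(2)] sum prod)
  also have "\<dots> = (1 - z\<^sup>2)\<^sup>2 + x * y * z * (1 + z\<^sup>2) + 2 * x * z\<^sup>2"
    by (simp add: power2_eq_square algebra_simps)
  finally show ?thesis ..
qed

text \<open>Put a = \<zeta> + \<zeta>', b = \<xi> + \<xi>', c = \<zeta>\<xi> + \<zeta>'\<xi>' and d
  = \<zeta>\<xi>' + \<zeta>'\<xi>. Then c + d = ab and cd = a^2 + b^2 - 4 = (a+b)^2 - 2ab - 4, which
  are again polynomials in x and y.\<close>

lemma pdo_pair_numerator_factorization: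
  fixes x y z \<zeta> \<zeta>' \<xi> \<xi>' :: "'a::comm_ring_1"
  assumes inv: "\<zeta> * \<zeta>' = 1" "\<xi> * \<xi>' = 1"
    and sum: "(\<zeta> + \<zeta>') + (\<xi> + \<xi>') = x * y" and prod: "(\<zeta> + \<zeta>') * (\<xi> + \<xi>') = 2 * x - 4"
  shows "(1 - z) ^ 4 + 2 * x * (1 - z)\<^sup>2 * z + x\<^sup>2 * y\<^sup>2 * z\<^sup>2 =
           (1 + \<zeta> * \<xi> * z) * (1 + \<zeta>' * \<xi>' * z) * ((1 + \<zeta> * \<xi>' * z) * (1 + \<zeta>' * \<xi> * z))"
proof -
  have "\<zeta> * \<xi> * (\<zeta>' * \<xi>') = (\<zeta> * \<zeta>') * (\<xi> * \<xi>')" "\<zeta> * \<xi>' * (\<zeta>' * \<xi>) = (\<zeta> * \<zeta>') * (\<xi> * \<xi>')"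
    by (simp_all only: mult_ac)
  hence inv': "\<zeta> * \<xi> * (\<zeta>' * \<xi>') = 1" "\<zeta> * \<xi>' * (\<zeta>' * \<xi>) = 1"
    unfolding inv by simp_all
  have cd: "(\<zeta> * \<xi> + \<zeta>' * \<xi>') + (\<zeta> * \<xi>' + \<zeta>' * \<xi>) = 2 * x - 4"
    unfolding prod[symmetric] by (simp add: algebra_simps)
  have "(\<zeta> * \<xi> + \<zeta>' * \<xi>') * (\<zeta> * \<xi>' + \<zeta>' * \<xi>) = 
      (\<xi> * \<xi>') * (\<zeta>\<^sup>2 + \<zeta>'\<^sup>2) + (\<zeta> * \<zeta>') * (\<xi>\<^sup>2 + \<xi>'\<^sup>2)"
    by (simp add: power2_eq_square algebra_simps)
  also have "\<dots> = (\<zeta>\<^sup>2 + \<zeta>'\<^sup>2) + (\<xi>\<^sup>2 + \<xi>'\<^sup>2)"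
    unfolding inv by simp
  also have "\<dots> = (\<zeta> + \<zeta>' + (\<xi> + \<xi>'))\<^sup>2 - 2 * (\<zeta> * \<zeta>') - 2 * (\<xi> * \<xi>') - 2 * ((\<zeta> + \<zeta>') * (\<xi> + \<xi>'))"
    by (simp add: power2_eq_square algebra_simps)
  also have "\<dots> = x\<^sup>2 * y\<^sup>2 - 4 - 2 * (2 * x - 4)"
    unfolding inv sum prod by (simp add: power_mult_distrib)
  finally have cd': "(\<zeta> * \<xi> + \<zeta>' * \<xi>') * (\<zeta> * \<xi>' + \<zeta>' * \<xi>) = x\<^sup>2 * y\<^sup>2 - 4 - 2 * (2 * x - 4)" .
  have "(1 + a * z + z\<^sup>2) * (1 + b * z + z\<^sup>2) = 1 + (a + b) * (z + z * z\<^sup>2) + (2 + a * b) * z\<^sup>2 + z\<^sup>2 * z\<^sup>2"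
    for a b by (simp add: power2_eq_square algebra_simps)
  hence "(1 + \<zeta> * \<xi> * z) * (1 + \<zeta>' * \<xi>' * z) * ((1 + \<zeta> * \<xi>' * z) * (1 + \<zeta>' * \<xi> * z)) =
     1 + (2 * x - 4) * (z + z * z\<^sup>2) + (2 + (x\<^sup>2 * y\<^sup>2 - 4 - 2 * (2 * x - 4))) * z\<^sup>2 + z\<^sup>2 * z\<^sup>2"
    by (simp only: reciprocal_linear_factors[OF inv'(1)] reciprocal_linear_factors[OF inv'(2)] cd cd')
  also have "\<dots> = (1 - z) ^ 4 + 2 * x * (1 - z)\<^sup>2 * z + x\<^sup>2 * y\<^sup>2 * z\<^sup>2"
    by (simp add: power2_eq_square power4_eq_xxxx algebra_simps)
  finally show ?thesis ..
qed

section \<open>Coefficients of the generating functions\<close>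

definition odds_below :: "nat \<Rightarrow> nat set" where
  "odds_below N = (\<lambda>k. 2 * k + 1) ` {..<N}"

lemma finite_odds_below: "finite (odds_below N)"
  and odd_odds_below: "\<forall>p\<in>odds_below N. odd p"
  by (auto simp: odds_below_def)

lemma prod_odds_below: "(\<Prod>p\<in>odds_below N. f p) = (\<Prod>k<N. f (2 * k + 1))"
  unfolding odds_below_def by (subst prod.reindex) (auto simp: inj_on_def)

text \<open>Parts are positive, so neither a part nor a multiplicity exceeds the weight; an odd part
  of size at most 2N is at most 2N - 1.\<close>

lemma mem_PDO_box_if_weight_le:
  assumes "\<rho> \<in> PDO" "weight \<rho> \<le> 2 * N"
  shows "\<rho> \<in> PDO_box (odds_below N) (2 * N)"
proof -
  have odd: "\<forall>p\<in>#fst \<rho>. odd p"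
    using assms(1) by (auto simp: PDO_def)
  hence pos: "\<forall>p\<in>#fst \<rho>. 0 < p"
    by (meson odd_pos)
  have "count (fst \<rho>) p \<le> 2 * N" for p
    using size_le_sum_mset[OF pos] count_le_size[of "fst \<rho>" p] assms(2) by (simp add: weight_def)
  moreover have "p \<in> odds_below N" if "p \<in># fst \<rho>" for p
  proof -
    have "p \<le> sum_mset (fst \<rho>)"
      using that by (metis insert_DiffM le_add1 sum_mset.add_mset)
    moreover obtain k where "p = 2 * k + 1" using odd \<open>p \<in># fst \<rho>\<close> by (metis oddE)
    ultimately show ?thesis using assms(2) by (auto simp: odds_below_def weight_def)
  qed
  ultimately show ?thesis using assms(1) by (auto simp: PDO_box_def mset_box_def)
qed

text \<open>In degrees up to \<open>2 * N\<close> the box contains every PDO partition, so the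
  finite product has the exact coefficients.\<close>

lemma PDO_box_product_nth:
  fixes X Y :: "'a::comm_ring_1"
  assumes "m \<le> 2 * N"
  shows "fps_nth (\<Prod>k<N. \<Sum>t\<le>2*N. pdo_term (fps_const X) (fps_const Y) (fps_X ^ (2*k+1)) t) m =
           (\<Sum>\<rho> | \<rho> \<in> PDO \<and> weight \<rho> = m. X ^ ell_d \<rho> * Y ^ ell_do \<rho>)"
proof -
  let ?B = "PDO_box (odds_below N) (2 * N)"
  have "fps_nth (\<Prod>k<N. \<Sum>t\<le>2*N. pdo_term (fps_const X) (fps_const Y) (fps_X ^ (2*k+1)) t) m =
      fps_nth (\<Sum>\<rho>\<in>?B. fps_const X ^ ell_d \<rho> * fps_const Y ^ ell_do \<rho> * fps_X ^ weight \<rho>) m"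
    unfolding sum_PDO_box_eq_prod[OF finite_odds_below odd_odds_below] prod_odds_below ..
  also have "\<dots> = (\<Sum>\<rho>\<in>?B. if weight \<rho> = m then X ^ ell_d \<rho> * Y ^ ell_do \<rho> else 0)"
    unfolding fps_sum_nth by (intro sum.cong) auto
  also have "\<dots> = (\<Sum>\<rho>\<in>{\<rho> \<in> ?B. weight \<rho> = m}. X ^ ell_d \<rho> * Y ^ ell_do \<rho>)"
    by (simp add: sum.inter_filter finite_PDO_box finite_odds_below odd_odds_below)
  also have "{\<rho> \<in> ?B. weight \<rho> = m} = {\<rho> \<in> PDO. weight \<rho> = m}"
    using mem_PDO_box_if_weight_le[of _ N] assms by (auto simp: PDO_box_def)
  finally show ?thesis by simp
qed

lemma PDO_box_pair_product_nth:
  fixes X Y :: "'a::comm_ring_1"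
  assumes "m \<le> 2 * N"
  shows "fps_nth (\<Prod>k<N. \<Sum>s\<le>2*N. \<Sum>t\<le>2*N. 
             pdo_pair_term (fps_const X) (fps_const Y) (fps_X ^ (2*k+1)) s t) m =
           (\<Sum>a | a \<in> PDO \<times> PDO \<and> weight (fst a) + weight (snd a) = m.
              X ^ (ell_d (fst a) + ell_d (snd a)) * Y ^ (2 * ell_r (fst a) (snd a)))"
proof -
  let ?B = "PDO_box (odds_below N) (2 * N)"
  have fin: "finite (?B \<times> ?B)"
    by (simp add: finite_PDO_box finite_odds_below odd_odds_below)
  have "fps_nth (\<Prod>k<N. \<Sum>s\<le>2*N. \<Sum>t\<le>2*N. 
             pdo_pair_term (fps_const X) (fps_const Y) (fps_X ^ (2*k+1)) s t) m =
      fps_nth (\<Sum>\<mu>\<in>?B. \<Sum>\<nu>\<in>?B. fps_const X ^ (ell_d \<mu> + ell_d \<nu>) * fps_const Y ^ (2 * ell_r \<mu> \<nu>)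
         * fps_X ^ (weight \<mu> + weight \<nu>)) m"
    unfolding sum_PDO_box_pair_eq_prod[OF finite_odds_below odd_odds_below] prod_odds_below ..
  also have "\<dots> = (\<Sum>a\<in>?B \<times> ?B. if weight (fst a) + weight (snd a) = m then 
      X ^ (ell_d (fst a) + ell_d (snd a)) * Y ^ (2 * ell_r (fst a) (snd a)) else 0)"
    unfolding sum.cartesian_product fps_sum_nth by (intro sum.cong) auto
  also have "\<dots> = (\<Sum>a\<in>{a \<in> ?B \<times> ?B. weight (fst a) + weight (snd a) = m}.
      X ^ (ell_d (fst a) + ell_d (snd a)) * Y ^ (2 * ell_r (fst a) (snd a)))"
    using fin by (simp add: sum.inter_filter)
  also have "{a \<in> ?B \<times> ?B. weight (fst a) + weight (snd a) = m} =
      {a \<in> PDO \<times> PDO. weight (fst a) + weight (snd a) = m}"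
    using mem_PDO_box_if_weight_le[of _ N] assms by (auto simp: PDO_box_def)
  finally show ?thesis by simp
qed

section \<open>The identity for complex values of the indeterminates\<close>

text \<open>The two roots of t^2 - a t + 1 have product 1, so each is the inverse of the
  other.\<close>

lemma obtain_joukowski:
  fixes a :: complex
  obtains \<zeta> where "\<zeta> \<noteq> 0" "\<zeta> + inverse \<zeta> = a"
proof -
  define r where "r = csqrt (a\<^sup>2 - 4)"
  have "(a + r) / 2 * ((a - r) / 2) = (a\<^sup>2 - r\<^sup>2) / 4"
    by (simp add: power2_eq_square algebra_simps)
  hence 1: "(a + r) / 2 * ((a - r) / 2) = 1" by (simp add: r_def)
  show ?thesis
  proof
    show "(a + r) / 2 \<noteq> 0" using 1 by (metis mult_zero_left zero_neq_one)
    have "inverse ((a + r) / 2) = (a - r) / 2" using 1 by (rule inverse_unique)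
    thus "(a + r) / 2 + inverse ((a + r) / 2) = a" by (simp add: field_simps)
  qed
qed

lemma obtain_sum_product:
  fixes s p :: complex
  obtains a b where "a + b = s" "a * b = p"
proof
  define r where "r = csqrt (s\<^sup>2 - 4 * p)"
  show "(s + r) / 2 + (s - r) / 2 = s" by (simp add: field_simps)
  have "(s + r) / 2 * ((s - r) / 2) = (s\<^sup>2 - r\<^sup>2) / 4"
    by (simp add: power2_eq_square algebra_simps)
  thus "(s + r) / 2 * ((s - r) / 2) = p" by (simp add: r_def)
qed

text \<open>Facts \<open>1\<close> and \<open>4\<close> clear denominators and express the products
  for partitions and for pairs by theta functions; \<open>2\<close> and \<open>3\<close> pass to the
  even part of the former. Both sides then carry the cofactor \<open>D\<close>, which
  cancels.\<close>

lemma PDO_statistics_eval_eq: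
  fixes X Y :: complex
  shows "(\<Sum>\<rho> | \<rho> \<in> PDO \<and> weight \<rho> = 2 * n. X ^ ell_d \<rho> * Y ^ ell_do \<rho>) =
     (\<Sum>a | a \<in> PDO \<times> PDO \<and> weight (fst a) + weight (snd a) = n.
        X ^ (ell_d (fst a) + ell_d (snd a)) * Y ^ (2 * ell_r (fst a) (snd a)))"
proof -
  obtain a b where ab: "a + b = X * Y" "a * b = 2 * X - 4" by (rule obtain_sum_product)
  obtain \<zeta> where \<zeta>: "\<zeta> \<noteq> 0" "\<zeta> + inverse \<zeta> = a" by (rule obtain_joukowski)
  obtain \<xi> where \<xi>: "\<xi> \<noteq> 0" "\<xi> + inverse \<xi> = b" by (rule obtain_joukowski)
  \<comment> \<open>Then \<open>2 * n \<le> N\<close> holds as the theta product lemma requires, and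
    precision \<open>2*N\<close> covers degree \<open>2 * n\<close>.\<close>
  define N where "N = 2 * n"
  let ?x = "fps_const X" and ?y = "fps_const Y"
  define z where "z = (\<lambda>k. fps_X ^ (2*k+1) :: complex fps)"
  define F where "F = (\<lambda>k. \<Sum>t\<le>2*N. pdo_term ?x ?y (z k) t)"
  define G where "G = (\<lambda>k. \<Sum>s\<le>2*N. \<Sum>t\<le>2*N. pdo_pair_term ?x ?y (z k) s t)"
  define J where "J = (\<lambda>u. \<Prod>k<N. (1 + fps_const u * z k) * (1 + fps_const (inverse u) * z k))"
  define Q where "Q = qfact ((fps_X :: complex fps)\<^sup>2) N"
  define R where "R = (\<Prod>k<N. 1 - z k)"
  define R2 where "R2 = (\<Prod>k<N. 1 - (z k)\<^sup>2)"
  \<comment> \<open>Passing to the even part turns \<open>R2\<close> into \<open>R\<close> and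
    \<open>Q\<close> into \<open>qfact fps_X N\<close>, so \<open>R2\<^sup>2 * Q\<^sup>2\<close>
    becomes \<open>D\<close>.\<close>
  define D where "D = R\<^sup>2 * (qfact (fps_X :: complex fps) N)\<^sup>2"
  have const_rel: "fps_const \<zeta> * fps_const (inverse \<zeta>) = 1" "fps_const \<xi> * fps_const (inverse \<xi>) = 1"
    "fps_const \<zeta> + fps_const (inverse \<zeta>) + (fps_const \<xi> + fps_const (inverse \<xi>)) = ?x * ?y"
    "(fps_const \<zeta> + fps_const (inverse \<zeta>)) * (fps_const \<xi> + fps_const (inverse \<xi>)) = 2 * ?x - 4"
    using \<zeta> \<xi> ab by (simp_all add: fps_numeral_fps_const)
  have J: "fps_eq_upto (2*N) (J u * Q) (theta N u)" if "u \<noteq> 0" for u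
    using jacobi_triple_product_upto[OF that, of N] unfolding J_def Q_def z_def .
  have zpow: "fps_eq_upto (2*N) (f + z k ^ (2*N+1) * g) f" for f g k
    unfolding z_def power_mult[symmetric] by (rule fps_eq_upto_add_X_power) simp

  have "fps_eq_upto (2*N) (F k * (1 - (z k)\<^sup>2)\<^sup>2) 
     ((1 + fps_const \<zeta> * z k) * (1 + fps_const (inverse \<zeta>) * z k) * ((1 + fps_const \<xi> * z k) * (1 + fps_const (inverse \<xi>) * z k)))" for k
    unfolding F_def sum_pdo_term pdo_numerator_factorization[OF const_rel] by (rule zpow)
  hence "fps_eq_upto (2*N) (\<Prod>k<N. F k * (1 - (z k)\<^sup>2)\<^sup>2) (J \<zeta> * J \<xi>)"
    unfolding J_def prod.distrib[symmetric] by (intro fps_eq_upto_prod)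
  hence "fps_eq_upto (2*N) (prod F {..<N} * R2\<^sup>2) (J \<zeta> * J \<xi>)"
    unfolding R2_def by (simp add: prod.distrib prod_power_distrib)
  hence "fps_eq_upto (2*N) (prod F {..<N} * R2\<^sup>2 * Q\<^sup>2) (J \<zeta> * J \<xi> * Q\<^sup>2)"
    by (rule fps_eq_upto_mult[OF _ fps_eq_upto_refl])
  also have "J \<zeta> * J \<xi> * Q\<^sup>2 = (J \<zeta> * Q) * (J \<xi> * Q)"
    by (simp add: power2_eq_square mult_ac)
  also have "fps_eq_upto (2*N) \<dots> (theta N \<zeta> * theta N \<xi>)"
    using \<zeta> \<xi> by (intro fps_eq_upto_mult J)
  finally have 1: "fps_eq_upto (2*N) (prod F {..<N} * R2\<^sup>2 * Q\<^sup>2) (theta N \<zeta> * theta N \<xi>)" .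

  \<comment> \<open>Written as single copies, the factors can be pulled out of the even part one at
    a time.\<close>
  have "prod F {..<N} * R2\<^sup>2 * Q\<^sup>2 = prod F {..<N} * R2 * R2 * Q * Q"
    by (simp add: power2_eq_square mult.assoc)
  moreover have "R2 = (\<Prod>k<N. 1 - fps_X ^ (2 * (2*k+1)))"
    unfolding R2_def z_def by (simp only: power_mult[symmetric] mult.commute)
  moreover have "Q = (\<Prod>k<N. 1 - fps_X ^ (2 * Suc k))"
    unfolding Q_def qfact_def by (simp only: power_mult)
  ultimately have 2: "fps_even_part (prod F {..<N} * R2\<^sup>2 * Q\<^sup>2) = fps_even_part (prod F {..<N}) * D"
    by (simp only: fps_even_part_mult_prod) (simp add: D_def R_def z_def qfact_def power2_eq_square mult.assoc)
  have 3: "fps_eq_upto n (fps_even_part (prod F {..<N}) * D) (theta N (\<zeta> * \<xi>) * theta N (\<zeta> / \<xi>))"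
    unfolding fps_eq_upto_def
  proof (intro allI impI)
    fix i assume i: "i \<le> n"
    have "fps_nth (fps_even_part (prod F {..<N}) * D) i = fps_nth (prod F {..<N} * R2\<^sup>2 * Q\<^sup>2) (2 * i)"
      unfolding 2[symmetric] by simp
    also have "\<dots> = fps_nth (theta N \<zeta> * theta N \<xi>) (2 * i)"
      using 1 i by (simp add: fps_eq_upto_def N_def)
    also have "\<dots> = fps_nth (theta N (\<zeta> * \<xi>) * theta N (\<zeta> / \<xi>)) i"
      using \<zeta> \<xi> i by (intro theta_product_even_nth) (simp_all add: N_def)
    finally show "fps_nth (fps_even_part (prod F {..<N}) * D) i = fps_nth (theta N (\<zeta> * \<xi>) * theta N (\<zeta> / \<xi>)) i" .
  qed

  have "fps_eq_upto (2*N) (G k * (1 - z k) ^ 4)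
      ((1 + fps_const (\<zeta> * \<xi>) * z k) * (1 + fps_const (inverse (\<zeta> * \<xi>)) * z k) *
       ((1 + fps_const (\<zeta> / \<xi>) * z k) * (1 + fps_const (inverse (\<zeta> / \<xi>)) * z k)))" for k
  proof -
    \<comment> \<open>After clearing denominators \<open>T\<close> occurs only through
      \<open>T * (1 - z k)\<^sup>2\<close>, which is \<open>z k\<close> to this precision.\<close>
    define T where "T = (\<Sum>t\<le>2*N. of_nat t * z k ^ t)"
    have T: "fps_eq_upto (2*N) (T * (1 - z k)\<^sup>2) (z k)"
      unfolding T_def sum_of_nat_mult_power by (rule zpow)
    have "G k * (1 - z k) ^ 4 = (1 - z k) ^ 4 + 2 * ?x * (1 - z k)\<^sup>2 * (T * (1 - z k)\<^sup>2) + ?x\<^sup>2 * ?y\<^sup>2 * (T * (1 - z k)\<^sup>2)\<^sup>2"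
      unfolding G_def sum_pdo_pair_term T_def[symmetric] by (simp add: algebra_simps power2_eq_square power4_eq_xxxx)
    also have "fps_eq_upto (2*N) \<dots> ((1 - z k) ^ 4 + 2 * ?x * (1 - z k)\<^sup>2 * z k + ?x\<^sup>2 * ?y\<^sup>2 * (z k)\<^sup>2)"
      by (intro fps_eq_upto_add fps_eq_upto_mult fps_eq_upto_power T fps_eq_upto_refl)
    finally show ?thesis
      unfolding pdo_pair_numerator_factorization[OF const_rel]
      by (simp add: divide_inverse mult_ac)
  qed
  hence "fps_eq_upto (2*N) (\<Prod>k<N. G k * (1 - z k) ^ 4) (J (\<zeta> * \<xi>) * J (\<zeta> / \<xi>))"
    unfolding J_def prod.distrib[symmetric] by (intro fps_eq_upto_prod)
  hence "fps_eq_upto (2*N) (prod G {..<N} * R ^ 4) (J (\<zeta> * \<xi>) * J (\<zeta> / \<xi>))"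
    unfolding R_def by (simp add: prod.distrib prod_power_distrib)
  hence "fps_eq_upto (2*N) (prod G {..<N} * R ^ 4 * Q\<^sup>2) (J (\<zeta> * \<xi>) * J (\<zeta> / \<xi>) * Q\<^sup>2)"
    by (rule fps_eq_upto_mult[OF _ fps_eq_upto_refl])
  also have "J (\<zeta> * \<xi>) * J (\<zeta> / \<xi>) * Q\<^sup>2 = (J (\<zeta> * \<xi>) * Q) * (J (\<zeta> / \<xi>) * Q)"
    by (simp add: power2_eq_square mult_ac)
  also have "fps_eq_upto (2*N) \<dots> (theta N (\<zeta> * \<xi>) * theta N (\<zeta> / \<xi>))"
    using \<zeta> \<xi> by (intro fps_eq_upto_mult J) auto
  finally have 4: "fps_eq_upto (2*N) (prod G {..<N} * R ^ 4 * Q\<^sup>2) (theta N (\<zeta> * \<xi>) * theta N (\<zeta> / \<xi>))" .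

  \<comment> \<open>\<open>R * Q\<close> is (X; X)_2N, which agrees with (X; X)_N up to degree N.
    Hence \<open>R ^ 4 * Q\<^sup>2\<close>, being \<open>R\<^sup>2 * (R * Q)\<^sup>2\<close>, agrees
    with \<open>D\<close>.\<close>
  have "fps_eq_upto N (qfact fps_X (2*N)) (qfact (fps_X :: complex fps) N)"
    using qfact_eq_upto[of N "2*N" N 1] by simp
  hence "fps_eq_upto N (R * Q) (qfact (fps_X :: complex fps) N)"
    unfolding R_def Q_def z_def prod_one_minus_X_odd_mult_qfact .
  hence "fps_eq_upto N (R\<^sup>2 * (R * Q)\<^sup>2) D"
    unfolding D_def by (intro fps_eq_upto_mult fps_eq_upto_power fps_eq_upto_refl)
  hence "fps_eq_upto N (prod G {..<N} * D) (prod G {..<N} * (R\<^sup>2 * (R * Q)\<^sup>2))"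
    by (intro fps_eq_upto_mult fps_eq_upto_refl fps_eq_upto_sym[of _ _ D])
  also have "prod G {..<N} * (R\<^sup>2 * (R * Q)\<^sup>2) = prod G {..<N} * R ^ 4 * Q\<^sup>2"
    by (simp add: power2_eq_square power4_eq_xxxx mult_ac)
  finally have "fps_eq_upto n (prod G {..<N} * D) (prod G {..<N} * R ^ 4 * Q\<^sup>2)"
    by (rule fps_eq_upto_mono) (simp add: N_def)
  also have "fps_eq_upto n \<dots> (theta N (\<zeta> * \<xi>) * theta N (\<zeta> / \<xi>))"
    using 4 by (rule fps_eq_upto_mono) (simp add: N_def)
  also have "fps_eq_upto n \<dots> (fps_even_part (prod F {..<N}) * D)"
    using 3 by (rule fps_eq_upto_sym)
  finally have "fps_eq_upto n (prod G {..<N}) (fps_even_part (prod F {..<N}))"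
  proof (rule fps_eq_upto_cancel)
    have "fps_nth R 0 = 1" unfolding R_def z_def by (induction N) simp_all
    moreover have "fps_nth (qfact (fps_X :: complex fps) N) 0 = 1"
      using qfact_fps_nth_0[where ?'a = complex, of 1 N] by simp
    ultimately show "fps_nth D 0 \<noteq> 0" by (simp add: D_def fps_nth_power_0)
  qed
  hence "fps_nth (prod F {..<N}) (2 * n) = fps_nth (prod G {..<N}) n"
    by (simp add: fps_eq_upto_def)
  thus ?thesis
    unfolding F_def G_def z_def
    by (subst (asm) PDO_box_product_nth, simp add: N_def, subst (asm) PDO_box_pair_product_nth) (simp_all add: N_def)
qed

section \<open>From complex values to joint statistics\<close>

text \<open>The sums are values of a polynomial in two variables whose coefficients are the
  multiplicities, and values over an infinite field determine the polynomial.\<close>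

lemma multiset_eq_if_evaluations_eq:
  fixes M N :: "(nat \<times> nat) multiset"
  assumes "\<And>X Y :: complex. (\<Sum>(k, j)\<in>#M. X ^ k * Y ^ j) = (\<Sum>(k, j)\<in>#N. X ^ k * Y ^ j)"
  shows "M = N"
proof -
  define P :: "(nat \<times> nat) multiset \<Rightarrow> complex poly poly" where
    "P = (\<lambda>M. \<Sum>(k, j)\<in>#M. monom (monom 1 k) j)"
  have eval: "poly (poly (P M) [:Y:]) X = (\<Sum>(k, j)\<in>#M. X ^ k * Y ^ j)" for M X Y
    by (induction M) (auto simp: P_def poly_monom)
  have coeff: "coeff (coeff (P M) j) k = of_nat (count M (k, j))" for M j k
    by (induction M) (auto simp: P_def split: if_splits)
  have "poly (P M) [:Y:] = poly (P N) [:Y:]" for Y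
    unfolding poly_eq_poly_eq_iff[symmetric] fun_eq_iff eval using assms by simp
  \<comment> \<open>The constants \<open>[:Y:]\<close> are infinitely many roots in the integral
    domain of polynomials in X, so the outer polynomial vanishes.\<close>
  hence "range (\<lambda>Y. [:Y:]) \<subseteq> {v. poly (P M - P N) v = 0}"
    by auto
  moreover have "infinite (range (\<lambda>Y :: complex. [:Y:]))"
    by (subst finite_image_iff) (auto simp: inj_on_def infinite_UNIV_char_0)
  ultimately have "P M - P N = 0"
    using poly_roots_finite finite_subset by blast
  hence "P M = P N" by simp
  thus ?thesis
    using coeff[of M] coeff[of N] by (metis multiset_eqI of_nat_eq_iff prod.exhaust)
qed

text \<open>This form yields both claims: cardinalities are multiplicities in the multiset, and
  coefficients over \<open>int poly poly\<close> are sums over it.\<close>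

lemma PDO_statistics_mset_eq:
  "image_mset (\<lambda>\<rho>. (ell_d \<rho>, ell_do \<rho>)) (mset_set {\<rho> \<in> PDO. weight \<rho> = 2 * n}) =
   image_mset (\<lambda>a. (ell_d (fst a) + ell_d (snd a), 2 * ell_r (fst a) (snd a)))
     (mset_set {a \<in> PDO \<times> PDO. weight (fst a) + weight (snd a) = n})"
  by (rule multiset_eq_if_evaluations_eq)
     (use PDO_statistics_eval_eq[of _ _ n] in \<open>simp add: multiset.map_comp comp_def sum_unfold_sum_mset\<close>)

lemma count_image_mset_set:
  "finite A \<Longrightarrow> count (image_mset f (mset_set A)) v = card {a \<in> A. f a = v}"
  by (simp add: count_image_mset vimage_def Int_def conj_commute)

theorem theorem3p4:
  shows "(\<forall>n k j :: nat. j \<le> k \<longrightarrow>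
            card {\<rho> \<in> PDO. weight \<rho> = 2 * n \<and> ell_d \<rho> = k \<and> ell_do \<rho> = j}
            = card {(\<mu>, \<nu>) \<in> PDO \<times> PDO. weight \<mu> + weight \<nu> = n \<and> ell_d \<mu> + ell_d \<nu> = k
                                     \<and> real (ell_r \<mu> \<nu>) = real j / 2})
         \<and> (\<forall>n :: nat. fps_nth P1 (2 * n) = fps_nth P2 n)"
proof (intro conjI allI impI)
  fix n k j :: nat
  \<comment> \<open>For odd \<open>j\<close> no pair satisfies either condition, and the claim is
    that the count of partitions is zero as well.\<close>
  have half: "real r = real j / 2 \<longleftrightarrow> 2 * r = j" for r
  proof
    assume "real r = real j / 2"
    hence "real (2 * r) = real j" by simp
    thus "2 * r = j" by (simp only: of_nat_eq_iff)
  qed auto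
  have "card {\<rho> \<in> PDO. weight \<rho> = 2 * n \<and> ell_d \<rho> = k \<and> ell_do \<rho> = j} =
      count (image_mset (\<lambda>\<rho>. (ell_d \<rho>, ell_do \<rho>)) (mset_set {\<rho> \<in> PDO. weight \<rho> = 2 * n})) (k, j)"
    unfolding count_image_mset_set[OF finite_PDO] by (rule arg_cong[of _ _ card]) auto
  also have "\<dots> = card {(\<mu>, \<nu>) \<in> PDO \<times> PDO. weight \<mu> + weight \<nu> = n \<and> ell_d \<mu> + ell_d \<nu> = k
                                     \<and> real (ell_r \<mu> \<nu>) = real j / 2}"
    unfolding PDO_statistics_mset_eq count_image_mset_set[OF finite_PDO_pairs]
    by (rule arg_cong[of _ _ card]) (auto simp: half)
  finally show "card {\<rho> \<in> PDO. weight \<rho> = 2 * n \<and> ell_d \<rho> = k \<and> ell_do \<rho> = j}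
            = card {(\<mu>, \<nu>) \<in> PDO \<times> PDO. weight \<mu> + weight \<nu> = n \<and> ell_d \<mu> + ell_d \<nu> = k
                                     \<and> real (ell_r \<mu> \<nu>) = real j / 2}" .
next
  fix n :: nat
  have "fps_nth P1 (2 * n) = (\<Sum>(k, j)\<in>#image_mset (\<lambda>\<rho>. (ell_d \<rho>, ell_do \<rho>)) (mset_set {\<rho> \<in> PDO. weight \<rho> = 2 * n}). var_x ^ k * var_y ^ j)"
    unfolding P1_nth by (simp add: multiset.map_comp comp_def sum_unfold_sum_mset)
  also have "\<dots> = fps_nth P2 n"
    unfolding PDO_statistics_mset_eq P2_nth
    by (simp add: multiset.map_comp comp_def sum_unfold_sum_mset case_prod_unfold mem_Times_iff)
  finally show "fps_nth P1 (2 * n) = fps_nth P2 n" .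
qed

end
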